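(* Let $G$ be a unicyclic graph with cycle $(v_0,\dots,v_{g-1})$, cycle edges $c_j=\{v_{j-1},v_j\}$ (indices mod $g$), in the balanced regime. Then the eigenvalue problem $R_Gz=\lambda z$ of the Ricci matrix $R_G$ decouples from the pendant trees, as follows. (1) Each pendant tree $B_v$ hanging off the cycle contributes, through a Schur complement (elimination of the coordinates of $z$ on the edges of $B_v$), a single scalar correction to the cycle diagonal at its attachment vertex $v$. This correction is the feedback $\Psi_v(\lambda)$, given explicitly by the continued fraction in the spectral parameter $\lambda$ written in the context: if $c,c'$ are the two cycle edges at $v$, the sum $\sigma_v$ of the coordinates of $z$ over the pendant edges incident to $v$ equals $\Psi_v(\lambda)(z_c+z_{c'})$. (2) What remains is a periodic eigenvalue problem along the cycle, for the cycle coordinates $z_j=z_{c_j}$: $$P_jz_{j+1}=Q_jz_j-P_{j-1}z_{j-1},\qquad P_j=\frac{1+\Psi_{v_j}(\lambda)}{d_{v_j}},\qquad Q_j=\lambda+\frac{1-\Psi_{v_{j-1}}(\lambda)}{d_{v_{j-1}}}+\frac{1-\Psi_{v_j}(\lambda)}{d_{v_j}}.$$ (3) Encode one step around the cycle as the $2\times2$ transfer matrix $T_j(\lambda)=\begin{pmatrix}Q_j/P_j&-P_{j-1}/P_j\\1&0\end{pmatrix}$. A real $\lambda$ that avoids the pendant-tree spectra (that is, $\lambda\notin\bigcup_v\sigma(R_{B_v})$) is an eigenvalue of $R_G$ with eigenvector supported on the cycle if and only if the ordered product of the $g$ transfer matrices around the cycle has trace exactly $2$: $$\operatorname{tr}\big(T_g(\lambda)\cdots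 T_1(\lambda)\big)=2.$$
   Context: Unicyclic: a finite connected graph with $|E|=|V|$; it is a cycle of girth $g\ge3$ with rooted trees (possibly trivial) attached at cycle vertices. $B_v$ is the tree hanging off the cycle vertex $v$, rooted at $v$; a pendant edge is any edge not on the cycle. $d_v$ is the degree of $v$ in $G$. Ricci matrix: $R_G\in\mathbb{R}^{E\times E}$ has diagonal entries $-(1/d_x+1/d_y)$ for $e=\{x,y\}$, entry $1/d_z$ for $e\neq e'$ with $e\cap e'=\{z\}$, and $0$ for disjoint edges. $R_{B_v}$ is the block of $R_G$ indexed by the edges of $B_v$, and $\sigma(R_{B_v})$ is its spectrum. Balanced regime: with $w^\ast>0$ the Perron eigenvector of $R_G$ (the positive eigenvector for the largest eigenvalue) and $L=\sum_jw^\ast(c_j)$, one has $w^\ast(c_{j-1})+w^\ast(c_j)+w^\ast(c_{j+1})\le L/2$ for every $j$. Feedback $\Psi_v$: orient $B_v$ away from $v$. For a leaf $u$ set $h_u=0$. For an internal vertex $u\ne v$ of $B_v$ set $$h_u=\frac{\beta_u}{1-\beta_u},\qquad \beta_u=\sum_{s\text{ child of }u}\frac{1}{d_u\lambda+2+d_u(1-h_s)/d_s}.$$ Then $$\Psi_v(\lambda)=\frac{\gamma_v}{1-\gamma_v},\qquad \gamma_v=\sum_u\frac{1}{d_v\lambda+2+d_v(1-h_u)/d_u},$$ with $u$ running over the children of $v$ in $B_v$ (so $\Psi_v=0$ if $B_v$ has no edges). These are rational functions of $\lambda$.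
   Formalization: In (3) it is also assumed that P_j(λ)≠0 for all j, as T_j is undefined otherwise; "supported on the cycle" means the cycle coordinates are not all zero; (1) is for λ outside σ(R_{B_v}), where the Schur complement exists, and (2) for λ outside all pendant-tree spectra. *)

theory Defs
  imports "HOL-Analysis.Analysis" "HOL-Computational_Algebra.Polynomial"
    "HOL-Computational_Algebra.Fraction_Field"
begin

text \<open>
  A finite simple graph is given by its edge set over a finite vertex type; the vertex set is the
  whole type.
\<close>

definition adj :: "'a set set \<Rightarrow> ('a \<times> 'a) set" where
  "adj F = {(x, y). {x, y} \<in> F}"

definition deg :: "'a set set \<Rightarrow> 'a \<Rightarrow> nat" where
  "deg E x = card {e \<in> E. x \<in> e}"

definition unicyclic :: "'a::finite set set \<Rightarrow> bool" where
  "unicyclic E \<longleftrightarrow> (\<forall>e\<in>E. card e = 2) \<and> (\<forall>x y. (x, y) \<in> (adj E)\<^sup>*) \<and> card E = CARD('a)"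

text \<open>
  Cyclic indices are integers: the cycle is a \<open>g\<close>-periodic sequence of vertices, injective on one
  period, so no explicit reduction modulo \<open>g\<close> is needed.
\<close>

definition cycle_edge :: "(int \<Rightarrow> 'a) \<Rightarrow> int \<Rightarrow> 'a set" where
  "cycle_edge v j = {v (j - 1), v j}"

abbreviation cycle_edges :: "(int \<Rightarrow> 'a) \<Rightarrow> 'a set set" where
  "cycle_edges v \<equiv> range (cycle_edge v)"

definition is_cycle :: "'a set set \<Rightarrow> nat \<Rightarrow> (int \<Rightarrow> 'a) \<Rightarrow> bool" where
  "is_cycle E g v \<longleftrightarrow> 3 \<le> g \<and> (\<forall>j. v (j + int g) = v j) \<and> inj_on v {0..<int g}
     \<and> cycle_edges v \<subseteq> E"

text \<open>
  Matrices are indexed by sets of edges. For distinct edges of a simple graph the intersection has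
  at most one element, so the off-diagonal sum below is \<open>1 / d z\<close> or \<open>0\<close>.
\<close>

definition ricci :: "'a set set \<Rightarrow> 'a set \<Rightarrow> 'a set \<Rightarrow> real" where
  "ricci E e f = (if e = f then - (\<Sum>x\<in>e. 1 / real (deg E x))
                  else (\<Sum>x\<in>e \<inter> f. 1 / real (deg E x)))"

definition mat_vec :: "('i \<Rightarrow> 'i \<Rightarrow> real) \<Rightarrow> 'i set \<Rightarrow> ('i \<Rightarrow> real) \<Rightarrow> 'i \<Rightarrow> real" where
  "mat_vec A I z e = (\<Sum>f\<in>I. A e f * z f)"

definition eigenvector_on :: "('i \<Rightarrow> 'i \<Rightarrow> real) \<Rightarrow> 'i set \<Rightarrow> real \<Rightarrow> ('i \<Rightarrow> real) \<Rightarrow> bool" where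
  "eigenvector_on A I l z \<longleftrightarrow> (\<exists>e\<in>I. z e \<noteq> 0) \<and> (\<forall>e\<in>I. mat_vec A I z e = l * z e)"

definition spectrum_on :: "('i \<Rightarrow> 'i \<Rightarrow> real) \<Rightarrow> 'i set \<Rightarrow> real set" where
  "spectrum_on A I = {l. \<exists>z. eigenvector_on A I l z}"

definition inverse_on :: "('i \<Rightarrow> 'i \<Rightarrow> real) \<Rightarrow> 'i set \<Rightarrow> ('i \<Rightarrow> 'i \<Rightarrow> real) \<Rightarrow> bool" where
  "inverse_on A I N \<longleftrightarrow> (\<forall>e\<in>I. \<forall>f\<in>I.
     (\<Sum>h\<in>I. A e h * N h f) = (if e = f then 1 else 0) \<and>
     (\<Sum>h\<in>I. N e h * A h f) = (if e = f then 1 else 0))"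

definition perron_vector :: "'a set set \<Rightarrow> ('a set \<Rightarrow> real) \<Rightarrow> bool" where
  "perron_vector E w \<longleftrightarrow> (\<forall>e\<in>E. 0 < w e) \<and>
     (\<exists>m. eigenvector_on (ricci E) E m w \<and> (\<forall>l\<in>spectrum_on (ricci E) E. l \<le> m))"

text \<open>The balance inequality is invariant under scaling of the Perron vector.\<close>

definition balanced :: "'a set set \<Rightarrow> nat \<Rightarrow> (int \<Rightarrow> 'a) \<Rightarrow> bool" where
  "balanced E g v \<longleftrightarrow> (\<exists>w. perron_vector E w \<and>
     (\<forall>j. w (cycle_edge v (j - 1)) + w (cycle_edge v j) + w (cycle_edge v (j + 1))
            \<le> (\<Sum>i\<in>{0..<int g}. w (cycle_edge v i)) / 2))"

text \<open>
  The tree hanging off a cycle vertex \<open>r\<close> is the component of \<open>r\<close> after deletion of the cycle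
  edges. It is oriented away from \<open>r\<close> by the distance to \<open>r\<close>.
\<close>

definition pendant_edges :: "'a set set \<Rightarrow> (int \<Rightarrow> 'a) \<Rightarrow> 'a set set" where
  "pendant_edges E v = E - cycle_edges v"

definition tree_verts :: "'a set set \<Rightarrow> (int \<Rightarrow> 'a) \<Rightarrow> 'a \<Rightarrow> 'a set" where
  "tree_verts E v r = (adj (pendant_edges E v))\<^sup>* `` {r}"

definition tree_edges :: "'a set set \<Rightarrow> (int \<Rightarrow> 'a) \<Rightarrow> 'a \<Rightarrow> 'a set set" where
  "tree_edges E v r = {e \<in> pendant_edges E v. e \<subseteq> tree_verts E v r}"

definition tree_dist :: "'a set set \<Rightarrow> (int \<Rightarrow> 'a) \<Rightarrow> 'a \<Rightarrow> 'a \<Rightarrow> nat" where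
  "tree_dist E v r u = (LEAST n. (r, u) \<in> adj (pendant_edges E v) ^^ n)"

definition children :: "'a set set \<Rightarrow> (int \<Rightarrow> 'a) \<Rightarrow> 'a \<Rightarrow> 'a \<Rightarrow> 'a set" where
  "children E v r u = {s \<in> tree_verts E v r. {u, s} \<in> tree_edges E v r \<and>
     tree_dist E v r s = Suc (tree_dist E v r u)}"

text \<open>
  The feedback is built in the field of rational functions and evaluated only afterwards:
  evaluating the recursion pointwise would go wrong wherever an inner fraction has a pole. The value
  at \<open>x\<close> is taken from any representation whose denominator does not vanish at \<open>x\<close>; it is
  unspecified at a pole.
\<close>

type_synonym ratfun = "real poly fract"

definition ratfun_var :: ratfun where
  "ratfun_var = Fract [:0, 1:] 1"

definition ratfun_regular :: "ratfun \<Rightarrow> real \<Rightarrow> bool" where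
  "ratfun_regular r x \<longleftrightarrow> (\<exists>p q. r = Fract p q \<and> poly q x \<noteq> 0)"

definition ratfun_eval :: "ratfun \<Rightarrow> real \<Rightarrow> real" where
  "ratfun_eval r x = (THE y. \<exists>p q. r = Fract p q \<and> poly q x \<noteq> 0 \<and> y = poly p x / poly q x)"

text \<open>
  \<open>feedback E v r u\<close> is \<open>h u\<close> in the tree rooted at \<open>r\<close>; for a leaf the sum is empty and the value
  is \<open>0\<close>. The recursion at the root itself, where \<open>beta\<close> is \<open>gamma\<close>, gives the function \<open>Psi\<close>.
\<close>

function feedback :: "'a::finite set set \<Rightarrow> (int \<Rightarrow> 'a) \<Rightarrow> 'a \<Rightarrow> 'a \<Rightarrow> ratfun" where
  "feedback E v r u =
     (let beta = (\<Sum>s\<in>children E v r u.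
             1 / (of_nat (deg E u) * ratfun_var + 2
                  + of_nat (deg E u) * (1 - feedback E v r s) / of_nat (deg E s)))
      in beta / (1 - beta))"
  by pat_completeness auto
termination
proof (relation "Wellfounded.measure (\<lambda>(E, v, r, u). card {x. tree_dist E v r u < tree_dist E v r x})")
  fix E :: "'a set set" and v :: "int \<Rightarrow> 'a" and r u s :: 'a
  assume "s \<in> children E v r u"
  then have "tree_dist E v r s = Suc (tree_dist E v r u)"
    by (simp add: children_def)
  then have "{x. tree_dist E v r s < tree_dist E v r x} \<subset> {x. tree_dist E v r u < tree_dist E v r x}"
    by (auto simp: psubset_eq set_eq_iff intro!: exI[of _ s])
  then show "((E, v, r, s), E, v, r, u)
      \<in> Wellfounded.measure (\<lambda>(E, v, r, u). card {x. tree_dist E v r u < tree_dist E v r x})"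
    by (simp add: psubset_card_mono)
qed simp

declare feedback.simps [simp del]

definition Psi :: "'a::finite set set \<Rightarrow> (int \<Rightarrow> 'a) \<Rightarrow> 'a \<Rightarrow> ratfun" where
  "Psi E v r = feedback E v r r"

definition coeff_P :: "'a::finite set set \<Rightarrow> (int \<Rightarrow> 'a) \<Rightarrow> real \<Rightarrow> int \<Rightarrow> real" where
  "coeff_P E v l j = (1 + ratfun_eval (Psi E v (v j)) l) / real (deg E (v j))"

definition coeff_Q :: "'a::finite set set \<Rightarrow> (int \<Rightarrow> 'a) \<Rightarrow> real \<Rightarrow> int \<Rightarrow> real" where
  "coeff_Q E v l j = l
     + (1 - ratfun_eval (Psi E v (v (j - 1))) l) / real (deg E (v (j - 1)))
     + (1 - ratfun_eval (Psi E v (v j)) l) / real (deg E (v j))"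

text \<open>
  The transfer matrix is meaningful only for \<open>coeff_P E v l j \<noteq> 0\<close>, i.e. away from the poles of its
  entries.
\<close>

definition transfer_mat :: "'a::finite set set \<Rightarrow> (int \<Rightarrow> 'a) \<Rightarrow> real \<Rightarrow> int \<Rightarrow> real^2^2" where
  "transfer_mat E v l j =
     vector [vector [coeff_Q E v l j / coeff_P E v l j, - coeff_P E v l (j - 1) / coeff_P E v l j],
             vector [1, 0]]"

text \<open>The latest factor stands on the left: \<open>T g ** \<dots> ** T 1\<close>.\<close>

definition monodromy :: "'a::finite set set \<Rightarrow> nat \<Rightarrow> (int \<Rightarrow> 'a) \<Rightarrow> real \<Rightarrow> real^2^2" where
  "monodromy E g v l = fold (\<lambda>j M. transfer_mat E v l j ** M) [1..int g] (mat 1)"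

end

theory Submission imports Defs begin

text \<open>
  Counting edges shows that the pendant edges are exactly the parent edges of the vertices off the
  cycle, so the equations on a pendant tree live on its vertices. Propagating the
  feedback from the root solves these equations over the field of rational functions. At a
  parameter outside the spectrum of the tree the solution has no pole, since clearing one would
  leave an eigenvector of the tree block; its value is then the unique real solution, and it
  yields the feedback, the Schur complement and the recurrence along the cycle. The monodromy of
  that recurrence has determinant \<open>1\<close>, so it has a fixed vector iff its trace is \<open>2\<close>.
\<close>

section \<open>Values of rational functions\<close>

text \<open>A feedback inside a tree can have a pole at an \<open>l\<close> outside the spectrum of
  the whole tree block, for instance where \<open>beta r s = 1\<close> at an inner vertex
  \<open>s\<close>. Regularity therefore cannot be carried up the recursion from the leaves. The
  object that stays regular is the solution of the tree equation normalised to 1 at the root;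
  \<open>Psi\<close> is its sum over the children of the root, and nothing is ever claimed about the
  value of an inner feedback at \<open>l\<close>. The root value plays two roles. With value 0 the
  tree equation is the eigenvalue equation of the tree block, which gives uniqueness. With value 1
  it is the same equation with a source \<open>1 / deg\<close> on the edges at the root, and this
  source is exactly the coupling of the tree to one cycle edge. Hence a single solution serves both
  the feedback and the Schur complement.\<close>

definition has_value :: "ratfun \<Rightarrow> real \<Rightarrow> real \<Rightarrow> bool" where
  "has_value r x y \<longleftrightarrow> (\<exists>p q. r = Fract p q \<and> poly q x \<noteq> 0 \<and> y = poly p x / poly q x)"

lemma has_valueI: "poly q x \<noteq> 0 \<Longrightarrow> has_value (Fract p q) x (poly p x / poly q x)"
  by (auto simp: has_value_def)

text \<open>Two representations without a pole at \<open>x\<close> agree after cross-multiplication.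
  This is what makes the \<open>THE\<close> in \<open>ratfun_eval\<close> meaningful.\<close>

lemma has_value_unique:
  assumes "has_value r x y" and "has_value r x y'"
  shows "y = y'"
proof -
  obtain p q where r: "r = Fract p q" and q: "poly q x \<noteq> 0" and y: "y = poly p x / poly q x"
    using assms(1) by (auto simp: has_value_def)
  obtain p' q' where r': "r = Fract p' q'" and q': "poly q' x \<noteq> 0"
    and y': "y' = poly p' x / poly q' x"
    using assms(2) by (auto simp: has_value_def)
  have "q \<noteq> 0" "q' \<noteq> 0" using q q' by auto
  then have "p * q' = p' * q" using r r' by (simp add: eq_fract)
  then have "poly p x * poly q' x = poly p' x * poly q x" by (metis poly_mult)
  then show ?thesis using q q' y y' by (simp add: frac_eq_eq)
qed

lemma ratfun_regular_iff: "ratfun_regular r x \<longleftrightarrow> (\<exists>y. has_value r x y)"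
  by (auto simp: ratfun_regular_def has_value_def)

lemma ratfun_eval_eqI:
  assumes "has_value r x y"
  shows "ratfun_eval r x = y"
proof -
  have "ratfun_eval r x = (THE y. has_value r x y)"
    by (simp add: ratfun_eval_def has_value_def)
  also have "\<dots> = y" using assms has_value_unique by blast
  finally show ?thesis .
qed

lemma has_value_add:
  assumes "has_value r x a" and "has_value s x b"
  shows "has_value (r + s) x (a + b)"
proof -
  obtain p q where r: "r = Fract p q" and q: "poly q x \<noteq> 0" and a: "a = poly p x / poly q x"
    using assms(1) by (auto simp: has_value_def)
  obtain p' q' where s: "s = Fract p' q'" and q': "poly q' x \<noteq> 0"
    and b: "b = poly p' x / poly q' x"
    using assms(2) by (auto simp: has_value_def)
  have "q \<noteq> 0" "q' \<noteq> 0" using q q' by auto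
  then have "r + s = Fract (p * q' + p' * q) (q * q')" using r s by simp
  moreover have "a + b = poly (p * q' + p' * q) x / poly (q * q') x"
    using a b q q' by (simp add: add_frac_eq)
  moreover have "poly (q * q') x \<noteq> 0" using q q' by simp
  ultimately show ?thesis using has_valueI by metis
qed

lemma has_value_mult:
  assumes "has_value r x a" and "has_value s x b"
  shows "has_value (r * s) x (a * b)"
proof -
  obtain p q where r: "r = Fract p q" and q: "poly q x \<noteq> 0" and a: "a = poly p x / poly q x"
    using assms(1) by (auto simp: has_value_def)
  obtain p' q' where s: "s = Fract p' q'" and q': "poly q' x \<noteq> 0"
    and b: "b = poly p' x / poly q' x"
    using assms(2) by (auto simp: has_value_def)
  have "r * s = Fract (p * p') (q * q')" using r s by simp
  moreover have "a * b = poly (p * p') x / poly (q * q') x" using a b by simp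
  moreover have "poly (q * q') x \<noteq> 0" using q q' by simp
  ultimately show ?thesis using has_valueI by metis
qed

lemma has_value_poly: "has_value (Fract p 1) x (poly p x)"
  unfolding has_value_def by (intro exI[of _ p] exI[of _ 1]) simp

lemma has_value_var: "has_value ratfun_var x x"
  using has_value_poly[of "[:0, 1:]" x] by (simp add: ratfun_var_def)

lemma has_value_of_nat: "has_value (of_nat n) x (real n)"
  using has_value_poly[of "of_nat n" x] by (simp add: Fract_of_nat_eq)

lemma has_value_diff:
  assumes "has_value r x a" and "has_value s x b"
  shows "has_value (r - s) x (a - b)"
proof -
  have "has_value (- 1) x (- 1)"
    using has_value_poly[of "- 1" x] by (simp add: One_fract_def)
  then show ?thesis
    using has_value_add[OF assms(1) has_value_mult[OF _ assms(2), of "- 1" "- 1"]] by simp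
qed

lemma has_value_divide_of_nat:
  assumes "has_value r x a" and "n > 0"
  shows "has_value (r / of_nat n) x (a / real n)"
proof -
  have "has_value (1 / of_nat n) x (1 / real n)"
    using assms(2) unfolding has_value_def
    by (intro exI[of _ 1] exI[of _ "of_nat n"]) (simp add: of_nat_fract One_fract_def)
  then show ?thesis using has_value_mult[OF assms(1)] by fastforce
qed

lemma has_value_sum:
  assumes "\<And>i. i \<in> I \<Longrightarrow> has_value (f i) x (a i)"
  shows "has_value (sum f I) x (sum a I)"
  using assms
proof (induction I rule: infinite_finite_induct)
  case (insert i I)
  then show ?case by (simp add: has_value_add)
qed (use has_value_of_nat[of 0 x] in auto)

section \<open>Poles at a point and the local parameter \<open>X - x\<close>\<close>

definition ratfun_local :: "real \<Rightarrow> ratfun" where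
  "ratfun_local x = Fract [:- x, 1:] 1"

lemma has_value_local: "has_value (ratfun_local x) x 0"
  using has_value_poly[of "[:- x, 1:]" x] by (simp add: ratfun_local_def)

lemma ratfun_local_nonzero: "ratfun_local x \<noteq> 0"
  by (simp add: ratfun_local_def Zero_fract_def eq_fract)

lemma ratfun_local_power: "ratfun_local x ^ k = Fract ([:- x, 1:] ^ k) 1"
  by (induction k) (simp_all add: ratfun_local_def One_fract_def)

lemma ratfun_regular_mult:
  "ratfun_regular r x \<Longrightarrow> ratfun_regular s x \<Longrightarrow> ratfun_regular (r * s) x"
  by (meson has_value_mult ratfun_regular_iff)

text \<open>The exponent is the multiplicity of \<open>x\<close> as a root of the
  denominator.\<close>

lemma ratfun_regular_clear_pole: "\<exists>k. ratfun_regular (ratfun_local x ^ k * r) x"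
proof -
  obtain p q where r: "r = Fract p q" and q: "q \<noteq> 0" by (cases r) auto
  obtain q' where q': "q = [:- x, 1:] ^ order x q * q'" and "\<not> [:- x, 1:] dvd q'"
    using order_decomp[OF q] by auto
  then have nz: "poly q' x \<noteq> 0" by (simp add: poly_eq_0_iff_dvd)
  have "ratfun_local x ^ order x q * r = Fract ([:- x, 1:] ^ order x q * p) ([:- x, 1:] ^ order x q * q')"
    using q' by (simp add: ratfun_local_power r)
  also have "\<dots> = Fract p q'"
    by (rule mult_fract_cancel) simp
  finally show ?thesis using nz unfolding ratfun_regular_def by blast
qed

text \<open>A larger power keeps regularity, so exponents that work separately can be added.\<close>

lemma ratfun_regular_clear_poles:
  assumes "finite I"
  shows "\<exists>k. \<forall>i\<in>I. ratfun_regular (ratfun_local x ^ k * f i) x"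
  using assms
proof (induction I rule: finite_induct)
  case (insert i I)
  have mono: "ratfun_regular (ratfun_local x ^ (k + m) * r) x"
    if "ratfun_regular (ratfun_local x ^ k * r) x" for k m r
  proof -
    have "ratfun_regular (ratfun_local x ^ m) x"
      by (metis has_value_poly ratfun_local_power ratfun_regular_iff)
    then have "ratfun_regular (ratfun_local x ^ m * (ratfun_local x ^ k * r)) x"
      using that by (rule ratfun_regular_mult)
    then show ?thesis by (simp add: power_add mult_ac)
  qed
  obtain k where k: "\<forall>i\<in>I. ratfun_regular (ratfun_local x ^ k * f i) x" using insert by blast
  obtain m where m: "ratfun_regular (ratfun_local x ^ m * f i) x"
    using ratfun_regular_clear_pole by blast
  show ?case using mono[of k _ m] mono[of m _ k] k m
    by (intro exI[of _ "k + m"]) (auto simp: add.commute)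
qed auto

lemma ratfun_regular_divide_local:
  assumes "has_value r x 0"
  shows "ratfun_regular (r / ratfun_local x) x"
proof -
  obtain p q where r: "r = Fract p q" and q: "poly q x \<noteq> 0" and "poly p x = 0"
    using assms by (auto simp: has_value_def)
  then obtain p' where "p = [:- x, 1:] * p'" by (auto simp: poly_eq_0_iff_dvd dvd_def)
  then have "r / ratfun_local x = Fract ([:- x, 1:] * p') ([:- x, 1:] * q)"
    by (simp add: r ratfun_local_def mult.commute)
  also have "\<dots> = Fract p' q" by (rule mult_fract_cancel) simp
  finally show ?thesis using q unfolding ratfun_regular_def by blast
qed

text \<open>
  The multiplier is the least power of \<open>X - x\<close> that clears all poles: with a smaller power some
  function keeps a pole, so its scaled value cannot vanish.
\<close>

lemma ratfun_scale_to_regular: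
  assumes "finite I" and "i \<in> I" and "\<not> ratfun_regular (f i) x"
  obtains m y where "has_value m x 0" and "\<And>i. i \<in> I \<Longrightarrow> has_value (m * f i) x (y i)"
    and "\<exists>i\<in>I. y i \<noteq> 0"
proof -
  define R where "R k \<longleftrightarrow> (\<forall>i\<in>I. ratfun_regular (ratfun_local x ^ k * f i) x)" for k
  define k where "k = (LEAST k. R k)"
  have Rk: "R k" unfolding k_def
    by (rule LeastI_ex) (use ratfun_regular_clear_poles[OF assms(1)] in \<open>auto simp: R_def\<close>)
  have "k \<noteq> 0"
  proof
    assume "k = 0"
    then show False using Rk assms(2,3) by (auto simp: R_def)
  qed
  then obtain n where n: "k = Suc n" using not0_implies_Suc by blast
  have "\<not> R n" using not_less_Least[of n R] n by (simp add: k_def)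
  then obtain a where a: "a \<in> I" "\<not> ratfun_regular (ratfun_local x ^ n * f a) x"
    by (auto simp: R_def)
  define y where "y i = ratfun_eval (ratfun_local x ^ k * f i) x" for i
  have y: "has_value (ratfun_local x ^ k * f i) x (y i)" if "i \<in> I" for i
    using Rk that ratfun_eval_eqI by (auto simp: R_def ratfun_regular_iff y_def)
  have "y a \<noteq> 0"
  proof
    assume "y a = 0"
    then have "ratfun_regular (ratfun_local x ^ k * f a / ratfun_local x) x"
      using y[OF a(1)] ratfun_regular_divide_local by simp
    then show False using a(2) n ratfun_local_nonzero[of x] by simp
  qed
  moreover have "has_value (ratfun_local x ^ k) x 0"
    using has_value_mult[OF has_value_local has_value_poly[of "[:- x, 1:] ^ n" x]]
    by (simp add: n ratfun_local_power)
  ultimately show thesis using that y a(1) by blast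
qed

text \<open>Polynomials are ordered by the sign of the leading coefficient, and fractions inherit
  this order; the variable is then infinitely large.\<close>

lemma ratfun_var_infinite: "of_nat n < ratfun_var"
proof -
  have "(of_nat n :: real poly) < [:0, 1:]"
    by (simp add: less_poly_def pos_poly_def of_nat_poly)
  then show ?thesis by (simp add: ratfun_var_def of_nat_fract)
qed

section \<open>Inverses of matrices indexed by finite sets\<close>

text \<open>\<open>A\<close> is padded by the identity outside \<open>I\<close>, so that the theory
  of square matrices over the full index type applies; injectivity on \<open>I\<close> then gives a
  left inverse, which is also a right inverse.\<close>

lemma inverse_on_exists:
  fixes A :: "'i::finite \<Rightarrow> 'i \<Rightarrow> real"
  assumes inj: "\<And>z. (\<And>e. e \<in> I \<Longrightarrow> mat_vec A I z e = 0) \<Longrightarrow> (\<And>e. e \<in> I \<Longrightarrow> z e = 0)"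
  shows "\<exists>N. inverse_on A I N"
proof -
  define M :: "real^'i^'i" where
    "M = (\<chi> e f. if e \<in> I \<and> f \<in> I then A e f else if e = f then 1 else 0)"
  have "x = 0" if "M *v x = 0" for x
  proof -
    have row: "(\<Sum>f\<in>UNIV. M $ e $ f * x $ f) = 0" for e
      using that by (simp add: matrix_vector_mult_def vec_eq_iff)
    have "mat_vec A I (\<lambda>f. x $ f) e = 0" if "e \<in> I" for e
    proof -
      have "mat_vec A I (\<lambda>f. x $ f) e = (\<Sum>f\<in>UNIV. M $ e $ f * x $ f)"
        unfolding mat_vec_def using that by (intro sum.mono_neutral_cong_left) (auto simp: M_def)
      then show ?thesis using row by simp
    qed
    then have on: "x $ e = 0" if "e \<in> I" for e using inj that by blast
    have "x $ e = 0" if "e \<notin> I" for e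
    proof -
      have "(\<Sum>f\<in>UNIV. M $ e $ f * x $ f) = (\<Sum>f\<in>UNIV. if e = f then x $ f else 0)"
        using that by (intro sum.cong) (auto simp: M_def)
      then show ?thesis using row[of e] by simp
    qed
    with on show ?thesis by (simp add: vec_eq_iff) blast
  qed
  then obtain N where NM: "N ** M = mat 1" using matrix_left_invertible_ker[of M] by blast
  then have MN: "M ** N = mat 1" using matrix_left_right_inverse by blast
  have "(\<Sum>h\<in>I. A e h * N $ h $ f) = (if e = f then 1 else 0)" if "e \<in> I" "f \<in> I" for e f
  proof -
    have "(\<Sum>h\<in>I. A e h * N $ h $ f) = (\<Sum>h\<in>UNIV. M $ e $ h * N $ h $ f)"
      using that by (intro sum.mono_neutral_cong_left) (auto simp: M_def)
    also have "\<dots> = (M ** N) $ e $ f" by (simp add: matrix_matrix_mult_def)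
    finally show ?thesis by (simp add: MN mat_def)
  qed
  moreover have "(\<Sum>h\<in>I. N $ e $ h * A h f) = (if e = f then 1 else 0)"
    if "e \<in> I" "f \<in> I" for e f
  proof -
    have "(\<Sum>h\<in>I. N $ e $ h * A h f) = (\<Sum>h\<in>UNIV. N $ e $ h * M $ h $ f)"
      using that by (intro sum.mono_neutral_cong_left) (auto simp: M_def)
    also have "\<dots> = (N ** M) $ e $ f" by (simp add: matrix_matrix_mult_def)
    finally show ?thesis by (simp add: NM mat_def)
  qed
  ultimately show ?thesis unfolding inverse_on_def
    by (intro exI[of _ "\<lambda>e f. N $ e $ f"]) blast
qed

section \<open>Trace and fixed vectors of a unimodular matrix\<close>

text \<open>For a matrix of size 2, \<open>det (M - mat 1) = det M - trace M + 1\<close>, which is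
  \<open>2 - trace M\<close> here.\<close>

lemma trace_2_iff_fixed_vector:
  fixes M :: "real^2^2"
  assumes "det M = 1"
  shows "trace M = 2 \<longleftrightarrow> (\<exists>x. x \<noteq> 0 \<and> M *v x = x)"
proof -
  have "(\<exists>x. x \<noteq> 0 \<and> M *v x = x) \<longleftrightarrow> \<not> (\<forall>x. (M - mat 1) *v x = 0 \<longrightarrow> x = 0)"
    by (auto simp: matrix_vector_mult_diff_rdistrib)
  also have "\<dots> \<longleftrightarrow> \<not> invertible (M - mat 1)"
    by (metis invertible_left_inverse matrix_left_invertible_ker)
  also have "\<dots> \<longleftrightarrow> det (M - mat 1) = 0" by (simp add: invertible_det_nz)
  also have "\<dots> \<longleftrightarrow> trace M = 2"
    using assms by (simp add: det_2 trace_def sum_2 mat_def) (auto simp: algebra_simps)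
  finally show ?thesis by blast
qed

section \<open>The pendant trees of a unicyclic graph\<close>

lemma adj_iff: "(x, y) \<in> adj F \<longleftrightarrow> {x, y} \<in> F"
  by (simp add: adj_def)

lemma adj_commute: "(x, y) \<in> adj F \<longleftrightarrow> (y, x) \<in> adj F"
  by (simp add: adj_iff insert_commute)

lemma periodic_cong:
  fixes w :: "int \<Rightarrow> 'b"
  assumes "\<And>j. w (j + int g) = w j" and "int g dvd i - j"
  shows "w i = w j"
proof -
  have up: "w (j + int g * int n) = w j" for j n
  proof (induction n)
    case (Suc n)
    then show ?case using assms(1)[of "j + int g * int n"] by (simp add: algebra_simps)
  qed simp
  obtain k where k: "i - j = int g * k" using assms(2) by (auto simp: dvd_def)
  show ?thesis
  proof (cases "0 \<le> k")
    case True
    then show ?thesis using up[of j "nat k"] k by (simp add: algebra_simps)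
  next
    case False
    then show ?thesis using up[of i "nat (- k)"] k by (simp add: algebra_simps)
  qed
qed

locale unicyclic_cycle =
  fixes E :: "'a::finite set set" and g :: nat and v :: "int \<Rightarrow> 'a"
  assumes unicyclic: "unicyclic E" and cycle: "is_cycle E g v"
begin

abbreviation "pendant \<equiv> pendant_edges E v"
abbreviation "cyc \<equiv> cycle_edge v"

lemma g_ge_3: "3 \<le> g"
  using cycle by (simp add: is_cycle_def)

lemma v_periodic: "v (j + int g) = v j"
  using cycle by (simp add: is_cycle_def)

lemma v_mod: "v (j mod int g) = v j"
  by (rule periodic_cong[of v, OF v_periodic]) (simp add: mod_eq_dvd_iff [symmetric])

lemma v_eq_iff: "v i = v j \<longleftrightarrow> int g dvd i - j"
proof
  assume "v i = v j"
  then have "v (i mod int g) = v (j mod int g)" by (simp add: v_mod)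
  moreover have "inj_on v {0..<int g}" using cycle by (simp add: is_cycle_def)
  ultimately have "i mod int g = j mod int g"
    using g_ge_3 by (auto dest!: inj_onD)
  then show "int g dvd i - j" by (rule mod_eq_dvd_iff[THEN iffD1])
next
  assume "int g dvd i - j"
  then show "v i = v j" by (rule periodic_cong[of v, OF v_periodic])
qed

text \<open>The bound \<open>3 \<le> g\<close> separates a cycle index from its neighbours and
  second neighbours.\<close>

lemma not_dvd_small: "\<bar>k\<bar> \<le> 2 \<Longrightarrow> k \<noteq> 0 \<Longrightarrow> \<not> int g dvd k"
  using g_ge_3 zdvd_not_zless[of "\<bar>k\<bar>" "int g"] by auto

text \<open>Two equal edges could also match crosswise, but then \<open>g\<close> would divide
  2.\<close>

lemma cycle_edge_eq_iff: "cyc i = cyc j \<longleftrightarrow> int g dvd i - j"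
proof
  assume "cyc i = cyc j"
  then have "v i = v j \<or> v (i - 1) = v j \<and> v i = v (j - 1)"
    by (auto simp: cycle_edge_def doubleton_eq_iff)
  moreover have False if "int g dvd i - 1 - j" "int g dvd i - (j - 1)"
    using dvd_diff[OF that(2,1)] not_dvd_small[of 2] by simp
  ultimately show "int g dvd i - j" by (auto simp: v_eq_iff)
next
  assume "int g dvd i - j"
  then have "v i = v j" "v (i - 1) = v (j - 1)" by (auto simp: v_eq_iff)
  then show "cyc i = cyc j" by (simp add: cycle_edge_def)
qed

text \<open>Kept general in \<open>f\<close> because it counts both the cycle vertices and the cycle
  edges.\<close>

lemma image_period:
  assumes "\<And>i j. f i = f j \<longleftrightarrow> int g dvd i - j"
  shows "range f = f ` {0..<int g}" and "card (range f) = g"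
proof -
  show *: "range f = f ` {0..<int g}"
  proof -
    have "f i = f (i mod int g)" for i using assms by (simp add: minus_mod_eq_mult_div)
    moreover have "i mod int g \<in> {0..<int g}" for i using g_ge_3 by auto
    ultimately show ?thesis by blast
  qed
  have "inj_on f {0..<int g}"
  proof
    fix i j assume "i \<in> {0..<int g}" "j \<in> {0..<int g}" "f i = f j"
    then show "i = j" using assms by (simp add: mod_eq_dvd_iff [symmetric])
  qed
  then show "card (range f) = g" unfolding * by (simp add: card_image)
qed

lemma cycle_edges_at: "{c \<in> cycle_edges v. v j \<in> c} = {cyc j, cyc (j + 1)}"
proof (intro set_eqI iffI)
  fix c assume "c \<in> {c \<in> cycle_edges v. v j \<in> c}"
  then obtain i where i: "c = cyc i" "v j \<in> cyc i" by auto
  then have "int g dvd j - (i - 1) \<or> int g dvd j - i"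
    by (auto simp: cycle_edge_def v_eq_iff)
  then have "cyc (j + 1) = cyc i \<or> cyc j = cyc i"
    by (auto simp: cycle_edge_eq_iff algebra_simps)
  then show "c \<in> {cyc j, cyc (j + 1)}" using i by auto
next
  fix c assume "c \<in> {cyc j, cyc (j + 1)}"
  moreover have "v j \<in> cyc j" "v j \<in> cyc (j + 1)" by (auto simp: cycle_edge_def)
  ultimately show "c \<in> {c \<in> cycle_edges v. v j \<in> c}" by blast
qed

lemma cycle_edge_Suc_neq: "cyc j \<noteq> cyc (j + 1)"
  using not_dvd_small[of "- 1"] by (simp add: cycle_edge_eq_iff)

lemma v_pred_neq: "v (j - 1) \<noteq> v j"
  using not_dvd_small[of "- 1"] by (simp add: v_eq_iff)

lemma cycle_edges_subset: "cycle_edges v \<subseteq> E"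
  using cycle by (simp add: is_cycle_def)

lemma cycle_edge_mem: "cyc j \<in> E"
  using cycle_edges_subset by auto

lemma cycle_edge_subset: "c \<in> cycle_edges v \<Longrightarrow> c \<subseteq> range v"
  by (auto simp: cycle_edge_def)

lemma deg_pos: "e \<in> E \<Longrightarrow> x \<in> e \<Longrightarrow> 0 < deg E x"
  by (auto simp: deg_def card_gt_0_iff)

section \<open>Orientation of the graph towards the cycle\<close>

definition depth :: "'a \<Rightarrow> nat" where
  "depth x = (LEAST n. \<exists>c\<in>range v. (c, x) \<in> adj E ^^ n)"

lemma depth_path: "\<exists>c\<in>range v. (c, x) \<in> adj E ^^ depth x"
proof -
  have "(v 0, x) \<in> (adj E)\<^sup>*" using unicyclic by (simp add: unicyclic_def)
  then obtain n where "(v 0, x) \<in> adj E ^^ n" using rtrancl_imp_relpow by blast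
  then show ?thesis unfolding depth_def
    by (intro LeastI_ex[of "\<lambda>n. \<exists>c\<in>range v. (c, x) \<in> adj E ^^ n"]) blast
qed

lemma depth_le: "c \<in> range v \<Longrightarrow> (c, x) \<in> adj E ^^ n \<Longrightarrow> depth x \<le> n"
  unfolding depth_def by (rule Least_le) blast

lemma depth_eq_0_iff: "depth x = 0 \<longleftrightarrow> x \<in> range v"
proof
  assume "depth x = 0"
  then show "x \<in> range v" using depth_path[of x] by auto
next
  assume "x \<in> range v"
  then show "depth x = 0" using depth_le[of x x 0] by auto
qed

text \<open>At this point a vertex might have several neighbours closer to the cycle, so one is
  chosen; the edge count in \<open>pendant_eq\<close> then excludes any other.\<close>

definition parent :: "'a \<Rightarrow> 'a" where
  "parent x = (SOME y. (y, x) \<in> adj E \<and> depth x = Suc (depth y))"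

lemma
  assumes "x \<notin> range v"
  shows parent_adj: "{x, parent x} \<in> E" and depth_parent: "depth x = Suc (depth (parent x))"
proof -
  obtain n where n: "depth x = Suc n" using assms depth_eq_0_iff not0_implies_Suc by blast
  obtain c where c: "c \<in> range v" "(c, x) \<in> adj E ^^ Suc n" using depth_path[of x] n by auto
  then obtain y where y: "(c, y) \<in> adj E ^^ n" "(y, x) \<in> adj E" by auto
  obtain d where d: "d \<in> range v" "(d, y) \<in> adj E ^^ depth y" using depth_path by blast
  have "depth x \<le> Suc (depth y)" using d y(2) by (intro depth_le[of d]) auto
  then have "depth x = Suc (depth y)" using depth_le[OF c(1) y(1)] n by simp
  then have "(parent x, x) \<in> adj E \<and> depth x = Suc (depth (parent x))"
    unfolding parent_def using y(2) someI[of "\<lambda>y. (y, x) \<in> adj E \<and> depth x = Suc (depth y)" y]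
    by blast
  then show "{x, parent x} \<in> E" "depth x = Suc (depth (parent x))"
    by (auto simp: adj_iff insert_commute)
qed

abbreviation parent_edge :: "'a \<Rightarrow> 'a set" where
  "parent_edge x \<equiv> {x, parent x}"

lemma parent_edge_inj: "inj_on parent_edge (- range v)"
proof
  fix x y assume "x \<in> - range v" "y \<in> - range v" "parent_edge x = parent_edge y"
  then show "x = y" using depth_parent[of x] depth_parent[of y]
    by (auto simp: doubleton_eq_iff)
qed

text \<open>
  Of the \<open>|E| = |V|\<close> edges, \<open>g\<close> lie on the cycle, so there are as many pendant edges as vertices off
  the cycle, and the parent edges exhaust them.
\<close>

lemma pendant_eq: "pendant = parent_edge ` (- range v)"
proof -
  have "parent_edge x \<in> pendant" if "x \<notin> range v" for x
    using parent_adj[OF that] cycle_edge_subset that by (auto simp: pendant_edges_def)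
  then have "parent_edge ` (- range v) \<subseteq> pendant" by auto
  moreover have "card (parent_edge ` (- range v)) = card pendant"
  proof -
    have "card (parent_edge ` (- range v)) = CARD('a) - g"
      using image_period(2)[OF v_eq_iff] card_Diff_subset[of "range v" UNIV]
      by (simp add: card_image[OF parent_edge_inj] del: Compl_eq_Diff_UNIV) (simp add: Compl_eq_Diff_UNIV)
    moreover have "card pendant = card E - g"
      unfolding pendant_edges_def using image_period(2)[OF cycle_edge_eq_iff] cycle_edges_subset
      by (simp add: card_Diff_subset)
    ultimately show ?thesis using unicyclic by (simp add: unicyclic_def)
  qed
  ultimately show ?thesis by (metis card_subset_eq finite)
qed

lemma pendant_subset: "pendant \<subseteq> E"
  by (auto simp: pendant_edges_def)

lemma edges_split: "E = pendant \<union> cycle_edges v" "pendant \<inter> cycle_edges v = {}"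
  using cycle_edges_subset by (auto simp: pendant_edges_def)

section \<open>Trees, distances and children in terms of parents\<close>

definition root :: "'a \<Rightarrow> 'a" where
  "root x = (parent ^^ depth x) x"

lemma root_parent: "x \<notin> range v \<Longrightarrow> root (parent x) = root x"
  using depth_parent[of x] by (simp add: root_def funpow_swap1)

lemma root_cycle: "x \<in> range v \<Longrightarrow> root x = x"
  using depth_eq_0_iff[of x] by (simp add: root_def)

lemma root_mem: "root x \<in> range v"
proof (induction "depth x" arbitrary: x)
  case 0
  then show ?case using depth_eq_0_iff root_cycle by metis
next
  case (Suc n)
  then have x: "x \<notin> range v" using depth_eq_0_iff[of x] by auto
  show ?case using Suc.hyps(1)[of "parent x"] Suc.hyps(2) depth_parent[OF x] root_parent[OF x] by simp
qed

lemma adj_pendantE: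
  assumes "(x, y) \<in> adj pendant"
  obtains "x \<notin> range v" "y = parent x" | "y \<notin> range v" "x = parent y"
  using assms unfolding adj_iff pendant_eq by (auto simp: doubleton_eq_iff)

lemma parent_adj_pendant: "x \<notin> range v \<Longrightarrow> (parent x, x) \<in> adj pendant"
  unfolding adj_commute[of "parent x"] by (auto simp: adj_iff pendant_eq)

lemma root_path: "(root x, x) \<in> adj pendant ^^ depth x"
proof (induction "depth x" arbitrary: x)
  case 0
  then show ?case using depth_eq_0_iff[of x] root_cycle[of x] by simp
next
  case (Suc n)
  then have x: "x \<notin> range v" using depth_eq_0_iff[of x] by auto
  have "(root x, parent x) \<in> adj pendant ^^ depth (parent x)"
    using Suc.hyps(1)[of "parent x"] Suc.hyps(2) depth_parent[OF x] root_parent[OF x] by simp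
  then show ?case using parent_adj_pendant[OF x] depth_parent[OF x] by auto
qed

text \<open>Every pendant edge joins a vertex to its parent, so one step keeps the root and changes
  the depth by exactly one. With \<open>root_path\<close> this identifies \<open>depth\<close> with
  \<open>tree_dist\<close> and the fibres of \<open>root\<close> with the trees.\<close>

lemma pendant_path:
  assumes "r \<in> range v" and "(r, x) \<in> adj pendant ^^ n"
  shows "root x = r" and "depth x \<le> n"
proof -
  have "root x = r \<and> depth x \<le> n" using assms(2)
  proof (induction n arbitrary: x)
    case 0
    then show ?case using assms(1) depth_eq_0_iff[of x] root_cycle[of x] by auto
  next
    case (Suc n)
    then obtain y where y: "(r, y) \<in> adj pendant ^^ n" "(y, x) \<in> adj pendant" by auto
    note IH = Suc.IH[OF y(1)]
    from y(2) show ?case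
    proof (cases rule: adj_pendantE)
      case 1
      then show ?thesis using IH depth_parent[of y] root_parent[of y] by auto
    next
      case 2
      then show ?thesis using IH depth_parent[of x] root_parent[of x] by auto
    qed
  qed
  then show "root x = r" "depth x \<le> n" by auto
qed

lemma tree_verts_eq:
  assumes "r \<in> range v"
  shows "tree_verts E v r = {x. root x = r}"
proof (intro set_eqI iffI)
  fix x assume "x \<in> tree_verts E v r"
  then obtain n where "(r, x) \<in> adj pendant ^^ n"
    unfolding tree_verts_def using rtrancl_imp_relpow by blast
  then show "x \<in> {x. root x = r}" using pendant_path(1)[OF assms] by blast
next
  fix x assume "x \<in> {x. root x = r}"
  then show "x \<in> tree_verts E v r"
    using root_path[of x] relpow_imp_rtrancl unfolding tree_verts_def by blast
qed

lemma tree_dist_eq: "r \<in> range v \<Longrightarrow> root x = r \<Longrightarrow> tree_dist E v r x = depth x"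
  unfolding tree_dist_def using root_path[of x] pendant_path(2)
  by (intro Least_equality) auto

definition kids :: "'a \<Rightarrow> 'a set" where
  "kids u = {s. s \<notin> range v \<and> parent s = u}"

definition twigs :: "'a \<Rightarrow> 'a set" where
  "twigs r = {x. x \<notin> range v \<and> root x = r}"

lemma tree_edges_eq: "r \<in> range v \<Longrightarrow> tree_edges E v r = parent_edge ` twigs r"
  unfolding tree_edges_def pendant_eq twigs_def by (auto simp: tree_verts_eq root_parent)

lemma tree_edges_subset: "tree_edges E v r \<subseteq> pendant"
  by (auto simp: tree_edges_def)

lemma children_eq: "r \<in> range v \<Longrightarrow> root u = r \<Longrightarrow> children E v r u = kids u"
proof (intro set_eqI iffI)
  fix s assume r: "r \<in> range v" "root u = r"
  {
    assume "s \<in> children E v r u"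
    then have s: "root s = r" "{u, s} \<in> pendant" "depth s = Suc (depth u)"
      using r by (auto simp: children_def tree_verts_eq tree_dist_eq tree_edges_def)
    from s(2) have "(u, s) \<in> adj pendant" by (simp add: adj_iff)
    then show "s \<in> kids u"
    proof (cases rule: adj_pendantE)
      case 1
      then show ?thesis using s(3) depth_parent[of u] by simp
    qed (simp add: kids_def)
  next
    assume "s \<in> kids u"
    then have s: "s \<notin> range v" "parent s = u" by (auto simp: kids_def)
    then have "root s = r" using r root_parent[of s] by simp
    moreover have "{u, s} \<in> tree_edges E v r"
      using s r \<open>root s = r\<close> by (auto simp: tree_edges_eq twigs_def insert_commute)
    ultimately show "s \<in> children E v r u"
      using r s depth_parent[of s] by (simp add: children_def tree_verts_eq tree_dist_eq)
  }
qed

lemma pendant_at: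
  "{e \<in> pendant. x \<in> e} = parent_edge ` (kids x \<union> (if x \<in> range v then {} else {x}))"
proof (intro set_eqI iffI)
  fix e assume "e \<in> {e \<in> pendant. x \<in> e}"
  then obtain y where y: "y \<notin> range v" "e = parent_edge y" "x = y \<or> x = parent y"
    unfolding pendant_eq by blast
  then have "y \<in> kids x \<union> (if x \<in> range v then {} else {x})" by (auto simp: kids_def)
  then show "e \<in> parent_edge ` (kids x \<union> (if x \<in> range v then {} else {x}))" using y(2) by blast
next
  fix e assume "e \<in> parent_edge ` (kids x \<union> (if x \<in> range v then {} else {x}))"
  then obtain y where y: "y \<in> kids x \<union> (if x \<in> range v then {} else {x})" "e = parent_edge y"
    by blast
  then have "y \<in> - range v" "x \<in> parent_edge y" by (auto simp: kids_def split: if_splits)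
  then show "e \<in> {e \<in> pendant. x \<in> e}" using y(2) unfolding pendant_eq by blast
qed

lemma sum_parent_edge: "A \<subseteq> - range v \<Longrightarrow> (\<Sum>e\<in>parent_edge ` A. z e) = (\<Sum>x\<in>A. z (parent_edge x))"
  using inj_on_subset[OF parent_edge_inj] by (subst sum.reindex) auto

end

section \<open>The eigenvalue equation on a pendant tree\<close>

text \<open>If the diagonal followed the off-diagonal rule it would be the sum of
  \<open>1 / deg\<close> over the ends of \<open>e\<close>; the true entry is its negative, hence
  the correction by \<open>2 * z e\<close>. A row thus depends only on the sums of \<open>z\<close>
  over the edges at the two ends of \<open>e\<close>.\<close>

lemma mat_vec_ricci:
  fixes E :: "'a::finite set set"
  shows "mat_vec (ricci E) F z e
    = (\<Sum>x\<in>e. ((\<Sum>f | f \<in> F \<and> x \<in> f. z f) - (if e \<in> F then 2 * z e else 0)) / real (deg E x))"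
proof -
  have entry: "ricci E e f * z f = (\<Sum>x\<in>e. (if x \<in> f then z f else 0) / real (deg E x))
      - (if e = f then (\<Sum>x\<in>e. 2 * z e / real (deg E x)) else 0)" for f
  proof (cases "e = f")
    case True
    have "(\<Sum>x\<in>e. 2 * z e / real (deg E x)) = 2 * (\<Sum>x\<in>e. z e / real (deg E x))"
      by (simp add: sum_distrib_left)
    moreover have "(\<Sum>x\<in>e. z e / real (deg E x)) = (\<Sum>x\<in>e. 1 / real (deg E x)) * z e"
      by (simp add: sum_distrib_right)
    ultimately show ?thesis using True by (simp add: ricci_def)
  next
    case False
    have "(\<Sum>x\<in>e. (if x \<in> f then z f else 0) / real (deg E x)) = (\<Sum>x\<in>e \<inter> f. z f / real (deg E x))"
      by (intro sum.mono_neutral_cong_right) auto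
    then show ?thesis using False by (simp add: ricci_def sum_distrib_right)
  qed
  have "mat_vec (ricci E) F z e = (\<Sum>f\<in>F. \<Sum>x\<in>e. (if x \<in> f then z f else 0) / real (deg E x))
      - (\<Sum>f\<in>F. if e = f then (\<Sum>x\<in>e. 2 * z e / real (deg E x)) else 0)"
    unfolding mat_vec_def entry by (rule sum_subtractf)
  also have "(\<Sum>f\<in>F. \<Sum>x\<in>e. (if x \<in> f then z f else 0) / real (deg E x))
      = (\<Sum>x\<in>e. (\<Sum>f | f \<in> F \<and> x \<in> f. z f) / real (deg E x))"
    by (subst sum.swap) (simp add: sum_divide_distrib sum.If_cases Int_def conj_commute
        flip: sum_divide_distrib)
  also have "(\<Sum>f\<in>F. if e = f then (\<Sum>x\<in>e. 2 * z e / real (deg E x)) else 0)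
      = (\<Sum>x\<in>e. (if e \<in> F then 2 * z e else 0) / real (deg E x))"
    by simp
  finally show ?thesis by (simp add: sum_subtractf diff_divide_distrib)
qed

context unicyclic_cycle
begin

definition kids_sum :: "('a \<Rightarrow> 'k::field) \<Rightarrow> 'a \<Rightarrow> 'k" where
  "kids_sum Y u = (\<Sum>s\<in>kids u. Y s)"

text \<open>
  The value at a vertex off the cycle stands for the coordinate on its parent edge; the value at the
  root stands for the sum of the two cycle coordinates there. The field is kept general because
  the equation is used both over the reals and over the rational functions.
\<close>

definition tree_op :: "('a \<Rightarrow> 'k::field) \<Rightarrow> 'a \<Rightarrow> 'k" where
  "tree_op Y x = (kids_sum Y x - Y x) / of_nat (deg E x)
     + (kids_sum Y (parent x) + Y (parent x) - 2 * Y x) / of_nat (deg E (parent x))"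

definition tree_eq :: "'k::field \<Rightarrow> 'a \<Rightarrow> ('a \<Rightarrow> 'k) \<Rightarrow> bool" where
  "tree_eq l r Y \<longleftrightarrow> (\<forall>x\<in>twigs r. l * Y x = tree_op Y x)"

text \<open>The root value \<open>a\<close> is 0 for the tree block alone and the sum of the two
  cycle coordinates for the full matrix.\<close>

definition vertex_fun :: "real \<Rightarrow> ('a set \<Rightarrow> real) \<Rightarrow> 'a \<Rightarrow> real" where
  "vertex_fun a z x = (if x \<in> range v then a else z (parent_edge x))"

definition edge_fun :: "('a \<Rightarrow> real) \<Rightarrow> 'a set \<Rightarrow> real" where
  "edge_fun y e = y (the_inv_into (- range v) parent_edge e)"

lemma edge_fun_parent_edge [simp]: "x \<notin> range v \<Longrightarrow> edge_fun y (parent_edge x) = y x"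
  using the_inv_into_f_f[OF parent_edge_inj] by (simp add: edge_fun_def)

lemma kids_subset: "kids u \<subseteq> - range v"
  by (auto simp: kids_def)

lemma kids_root: "s \<in> kids u \<Longrightarrow> s \<in> twigs (root u)"
  using root_parent[of s] by (auto simp: kids_def twigs_def)

lemma parent_in_tree: "x \<in> twigs r \<Longrightarrow> parent x = r \<or> parent x \<in> twigs r"
  using root_parent[of x] root_cycle[of "parent x"] by (auto simp: twigs_def)

lemma kids_in_tree: "r \<in> range v \<Longrightarrow> u = r \<or> u \<in> twigs r \<Longrightarrow> kids u \<subseteq> twigs r"
  using kids_root[of _ u] root_cycle[of r] by (auto simp: twigs_def)

lemma parent_neq: "x \<notin> range v \<Longrightarrow> parent x \<noteq> x"
  using depth_parent[of x] by (metis n_not_Suc_n)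

lemma deg_parent_pos: "x \<notin> range v \<Longrightarrow> 0 < deg E (parent x)"
  and deg_off_cycle_pos: "x \<notin> range v \<Longrightarrow> 0 < deg E x"
  using deg_pos[OF parent_adj] by auto

lemma tree_op_cong:
  assumes "r \<in> range v" and "\<And>x. x = r \<or> x \<in> twigs r \<Longrightarrow> Y x = Y' x" and "x \<in> twigs r"
  shows "tree_op Y x = tree_op Y' x"
proof -
  have "kids_sum Y u = kids_sum Y' u" if "u = r \<or> u \<in> twigs r" for u
    unfolding kids_sum_def using kids_in_tree[OF assms(1) that] assms(2)
    by (intro sum.cong) auto
  then show ?thesis unfolding tree_op_def using parent_in_tree[OF assms(3)] assms(2,3) by metis
qed

lemma tree_eq_cong:
  assumes "r \<in> range v" and "\<And>x. x = r \<or> x \<in> twigs r \<Longrightarrow> Y x = Y' x"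
  shows "tree_eq l r Y \<longleftrightarrow> tree_eq l r Y'"
  unfolding tree_eq_def using tree_op_cong[OF assms] assms(2) by auto

lemma tree_op_scale: "tree_op (\<lambda>x. a * Y x) x = a * tree_op Y x"
  by (simp add: tree_op_def kids_sum_def flip: sum_distrib_left)
    (simp add: algebra_simps add_divide_distrib diff_divide_distrib)

lemma tree_op_diff: "tree_op (\<lambda>x. Y x - Y' x) x = tree_op Y x - tree_op Y' x"
  by (simp add: tree_op_def kids_sum_def sum_subtractf)
    (simp add: algebra_simps add_divide_distrib diff_divide_distrib)

lemma tree_eq_scale: "tree_eq l r Y \<Longrightarrow> tree_eq l r (\<lambda>x. a * Y x)"
  by (simp add: tree_eq_def tree_op_scale mult.left_commute)

lemma tree_eq_diff: "tree_eq l r Y \<Longrightarrow> tree_eq l r Y' \<Longrightarrow> tree_eq l r (\<lambda>x. Y x - Y' x)"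
  by (simp add: tree_eq_def tree_op_diff right_diff_distrib)

lemma kids_sum_vertex_fun: "kids_sum (vertex_fun a z) u = (\<Sum>s\<in>kids u. z (parent_edge s))"
  unfolding kids_sum_def vertex_fun_def using kids_subset[of u] by (intro sum.cong) auto

lemma kids_sum_edge_fun: "kids_sum (vertex_fun a (edge_fun y)) u = kids_sum y u"
proof -
  have "edge_fun y (parent_edge s) = y s" if "s \<in> kids u" for s
    using that kids_subset[of u] by auto
  then show ?thesis unfolding kids_sum_vertex_fun unfolding kids_sum_def by (rule sum.cong[OF refl])
qed

lemma sum_pendant_at: "(\<Sum>f | f \<in> pendant \<and> x \<in> f. z f) = kids_sum (vertex_fun 0 z) x + vertex_fun 0 z x"
proof (cases "x \<in> range v")
  case True
  then show ?thesis
    by (simp add: pendant_at kids_sum_vertex_fun sum_parent_edge[OF kids_subset] vertex_fun_def)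
next
  case False
  then have "x \<notin> kids x" using parent_neq by (auto simp: kids_def)
  then show ?thesis using False kids_subset[of x]
    by (simp add: pendant_at kids_sum_vertex_fun vertex_fun_def
        sum_parent_edge[of "insert x (kids x)", unfolded image_insert])
qed

text \<open>Both ends of a pendant edge have the same root, so all pendant edges at a vertex of the
  tree belong to this tree.\<close>

lemma sum_tree_at:
  assumes "r \<in> range v" and "x = r \<or> x \<in> twigs r"
  shows "(\<Sum>f | f \<in> tree_edges E v r \<and> x \<in> f. z f) = (\<Sum>f | f \<in> pendant \<and> x \<in> f. z f)"
proof -
  have "f \<in> tree_edges E v r" if "f \<in> pendant" "x \<in> f" for f
  proof -
    obtain y where y: "y \<notin> range v" "f = parent_edge y" using \<open>f \<in> pendant\<close> by (auto simp: pendant_eq)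
    then have "root y = root x" using \<open>x \<in> f\<close> root_parent by auto
    then have "y \<in> twigs r" using assms y root_cycle by (auto simp: twigs_def)
    then show ?thesis using y assms(1) by (simp add: tree_edges_eq)
  qed
  then have "{f. f \<in> tree_edges E v r \<and> x \<in> f} = {f. f \<in> pendant \<and> x \<in> f}"
    using tree_edges_subset by blast
  then show ?thesis by simp
qed

lemma sum_edges_at:
  "(\<Sum>f | f \<in> E \<and> x \<in> f. z f) = (\<Sum>f | f \<in> pendant \<and> x \<in> f. z f) + (\<Sum>f | f \<in> cycle_edges v \<and> x \<in> f. z f)"
proof -
  have "{f. f \<in> E \<and> x \<in> f} = {f. f \<in> pendant \<and> x \<in> f} \<union> {f. f \<in> cycle_edges v \<and> x \<in> f}"
    using edges_split(1) by blast
  then show ?thesis using edges_split(2) by (simp add: sum.union_disjoint disjoint_iff)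
qed

lemma sum_cycle_at: "(\<Sum>f | f \<in> cycle_edges v \<and> v j \<in> f. z f) = z (cyc j) + z (cyc (j + 1))"
  unfolding cycle_edges_at using cycle_edge_Suc_neq by simp

lemma sum_cycle_off: "x \<notin> range v \<Longrightarrow> (\<Sum>f | f \<in> cycle_edges v \<and> x \<in> f. z f) = 0"
  using cycle_edge_subset by (intro sum.neutral) blast

lemma mat_vec_tree:
  assumes "r \<in> range v" and x: "x \<in> twigs r"
  shows "mat_vec (ricci E) (tree_edges E v r) z (parent_edge x) = tree_op (vertex_fun 0 z) x"
proof -
  have off: "x \<notin> range v" using x by (simp add: twigs_def)
  have mem: "parent_edge x \<in> tree_edges E v r" using assms by (simp add: tree_edges_eq)
  have "x \<noteq> parent x" using parent_neq[OF off] by simp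
  then have "mat_vec (ricci E) (tree_edges E v r) z (parent_edge x)
     = (kids_sum (vertex_fun 0 z) x + vertex_fun 0 z x - 2 * z (parent_edge x)) / real (deg E x)
     + (kids_sum (vertex_fun 0 z) (parent x) + vertex_fun 0 z (parent x) - 2 * z (parent_edge x))
        / real (deg E (parent x))"
    using mem parent_in_tree[OF x] assms
    by (simp add: mat_vec_ricci sum_tree_at[OF assms(1)] sum_pendant_at)
  moreover have "vertex_fun 0 z x = z (parent_edge x)" using off by (simp add: vertex_fun_def)
  ultimately show ?thesis by (simp add: tree_op_def)
qed

text \<open>Only the sum of edge coordinates at the attachment vertex sees the cycle, and it sees
  just the two cycle edges there. The cycle therefore enters the tree equation through a single
  number, the root value.\<close>

lemma mat_vec_edges:
  assumes x: "x \<in> twigs (v j)"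
  shows "mat_vec (ricci E) E z (parent_edge x)
    = tree_op (vertex_fun (z (cyc j) + z (cyc (j + 1))) z) x"
proof -
  let ?y = "vertex_fun (z (cyc j) + z (cyc (j + 1))) z"
  have off: "x \<notin> range v" using x by (simp add: twigs_def)
  have at: "(\<Sum>f | f \<in> E \<and> u \<in> f. z f) = kids_sum ?y u + ?y u"
    if "u = v j \<or> u \<in> twigs (v j)" for u
    using that
  proof
    assume "u = v j"
    then show ?thesis
      by (simp add: sum_edges_at sum_pendant_at sum_cycle_at kids_sum_vertex_fun vertex_fun_def)
  next
    assume "u \<in> twigs (v j)"
    then have "u \<notin> range v" by (simp add: twigs_def)
    then show ?thesis
      by (simp add: sum_edges_at sum_pendant_at sum_cycle_off kids_sum_vertex_fun vertex_fun_def)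
  qed
  have "x \<noteq> parent x" using parent_neq[OF off] by simp
  then have "mat_vec (ricci E) E z (parent_edge x)
     = (kids_sum ?y x + ?y x - 2 * z (parent_edge x)) / real (deg E x)
     + (kids_sum ?y (parent x) + ?y (parent x) - 2 * z (parent_edge x)) / real (deg E (parent x))"
    using parent_adj[OF off] parent_in_tree[OF x] x by (simp add: mat_vec_ricci at)
  moreover have "?y x = z (parent_edge x)" using off by (simp add: vertex_fun_def)
  ultimately show ?thesis by (simp add: tree_op_def)
qed

lemma mat_vec_cycle:
  "mat_vec (ricci E) E z (cyc j)
    = ((\<Sum>f | f \<in> pendant \<and> v (j - 1) \<in> f. z f) + z (cyc (j - 1)) - z (cyc j)) / real (deg E (v (j - 1)))
    + ((\<Sum>f | f \<in> pendant \<and> v j \<in> f. z f) + z (cyc (j + 1)) - z (cyc j)) / real (deg E (v j))"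
proof -
  have "mat_vec (ricci E) E z (cyc j)
    = ((\<Sum>f | f \<in> E \<and> v (j - 1) \<in> f. z f) - 2 * z (cyc j)) / real (deg E (v (j - 1)))
    + ((\<Sum>f | f \<in> E \<and> v j \<in> f. z f) - 2 * z (cyc j)) / real (deg E (v j))"
    using v_pred_neq[of j] cycle_edge_mem[of j]
    by (simp add: mat_vec_ricci cycle_edge_def[of v j])
  then show ?thesis using sum_cycle_at[of z "j - 1"] by (simp add: sum_edges_at sum_cycle_at algebra_simps)
qed

lemma tree_equations_iff:
  "(\<forall>e\<in>tree_edges E v (v j). mat_vec (ricci E) E z e = l * z e)
    \<longleftrightarrow> tree_eq l (v j) (vertex_fun (z (cyc j) + z (cyc (j + 1))) z)"
proof -
  have "mat_vec (ricci E) E z (parent_edge x) = l * z (parent_edge x)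
      \<longleftrightarrow> l * vertex_fun (z (cyc j) + z (cyc (j + 1))) z x
        = tree_op (vertex_fun (z (cyc j) + z (cyc (j + 1))) z) x" if "x \<in> twigs (v j)" for x
    using that mat_vec_edges[OF that, of z] by (auto simp: twigs_def vertex_fun_def)
  then show ?thesis by (simp add: tree_edges_eq tree_eq_def)
qed

text \<open>With root value 0 the tree equation is the eigenvalue equation of the tree block, so a
  nonzero solution would put \<open>l\<close> into its spectrum.\<close>

lemma tree_eq_unique:
  assumes r: "r \<in> range v" and l: "l \<notin> spectrum_on (ricci E) (tree_edges E v r)"
    and eq: "tree_eq l r y" and 0: "y r = 0" and x: "x \<in> twigs r"
  shows "y x = 0"
proof (rule ccontr)
  assume "y x \<noteq> 0"
  have "vertex_fun 0 (edge_fun y) u = y u" if "u = r \<or> u \<in> twigs r" for u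
    using that r 0 by (auto simp: vertex_fun_def twigs_def)
  then have "tree_eq l r (vertex_fun 0 (edge_fun y))" using eq tree_eq_cong[OF r] by blast
  then have "\<forall>e\<in>tree_edges E v r. mat_vec (ricci E) (tree_edges E v r) (edge_fun y) e = l * edge_fun y e"
    using mat_vec_tree[OF r] by (auto simp: tree_edges_eq[OF r] tree_eq_def twigs_def vertex_fun_def)
  moreover have "parent_edge x \<in> tree_edges E v r" "edge_fun y (parent_edge x) \<noteq> 0"
    using x \<open>y x \<noteq> 0\<close> by (auto simp: tree_edges_eq[OF r] twigs_def)
  ultimately have "eigenvector_on (ricci E) (tree_edges E v r) l (edge_fun y)"
    unfolding eigenvector_on_def by blast
  then show False using l by (auto simp: spectrum_on_def)
qed

section \<open>The feedback solves the tree equation over the rational functions\<close>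

definition denom :: "'a \<Rightarrow> 'a \<Rightarrow> 'a \<Rightarrow> ratfun" where
  "denom r u s = of_nat (deg E u) * ratfun_var + 2
     + of_nat (deg E u) * (1 - feedback E v r s) / of_nat (deg E s)"

definition beta :: "'a \<Rightarrow> 'a \<Rightarrow> ratfun" where
  "beta r u = (\<Sum>s\<in>kids u. 1 / denom r u s)"

lemma feedback_eq: "r \<in> range v \<Longrightarrow> root u = r \<Longrightarrow> feedback E v r u = beta r u / (1 - beta r u)"
  by (subst feedback.simps) (simp add: children_eq beta_def denom_def Let_def)

text \<open>
  In the order of the field of rational functions the variable exceeds every constant, which keeps
  all denominators of the continued fraction positive.
\<close>

lemma denom_ge:
  assumes "s \<in> kids u" and "feedback E v r s \<le> 1"
  shows "ratfun_var \<le> denom r u s"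
proof -
  have X: "0 < ratfun_var" using ratfun_var_infinite[of 0] by simp
  have "0 < deg E u" using assms(1) deg_parent_pos by (auto simp: kids_def)
  then have "(1 :: ratfun) \<le> of_nat (deg E u)" by simp
  then have "ratfun_var \<le> of_nat (deg E u) * ratfun_var" using X by (simp add: mult_le_cancel_right1)
  moreover have "0 \<le> of_nat (deg E u) * (1 - feedback E v r s) / of_nat (deg E s)"
    using assms(2) by simp
  ultimately show ?thesis unfolding denom_def by linarith
qed

text \<open>Induction from the leaves towards the root. The upper bound 1 for the children keeps
  each denominator at least \<open>ratfun_var\<close>, so \<open>beta\<close> is at most a constant
  over \<open>ratfun_var\<close>. The threshold \<open>1 / 2\<close> is the one for which
  \<open>beta / (1 - beta) \<le> 1\<close>, which closes the induction.\<close>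

lemma feedback_bounds:
  assumes "r \<in> range v" and "root u = r"
  shows "0 \<le> beta r u \<and> beta r u \<le> 1 / 2 \<and> 0 \<le> feedback E v r u \<and> feedback E v r u \<le> 1"
  using assms(2)
proof (induction "Max (range depth) - depth u" arbitrary: u rule: less_induct)
  case less
  have X: "0 < ratfun_var" using ratfun_var_infinite[of 0] by simp
  have bound: "0 \<le> 1 / denom r u s \<and> 1 / denom r u s \<le> 1 / ratfun_var" if s: "s \<in> kids u" for s
  proof -
    have "depth s = Suc (depth u)" using s depth_parent by (auto simp: kids_def)
    moreover have "depth s \<le> Max (range depth)" by simp
    moreover have "root s = r" using kids_root[OF s] less.prems by (simp add: twigs_def)
    ultimately have "feedback E v r s \<le> 1" using less.hyps[of s] by auto
    then have "ratfun_var \<le> denom r u s" using denom_ge[OF s] by blast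
    then show ?thesis using X by (auto intro!: divide_left_mono)
  qed
  have b0: "0 \<le> beta r u" unfolding beta_def using bound by (intro sum_nonneg) auto
  have "beta r u \<le> of_nat (card (kids u)) * (1 / ratfun_var)"
    unfolding beta_def using bound by (intro sum_bounded_above) auto
  also have "\<dots> \<le> 1 / 2"
    using X ratfun_var_infinite[of "2 * card (kids u)"] by (simp add: field_simps)
  finally have b1: "beta r u \<le> 1 / 2" .
  then have "beta r u \<le> 1 - beta r u" "0 < 1 - beta r u" by (simp_all add: field_simps)
  then show ?case using b0 b1 feedback_eq[OF assms(1) less.prems] by simp
qed

text \<open>The product, along the path from the root down to \<open>x\<close>, of one factor
  \<open>(1 + h) / denom\<close> per edge. The number of remaining steps is an argument to make the
  recursion primitive.\<close>

primrec branch_weight :: "'a \<Rightarrow> nat \<Rightarrow> 'a \<Rightarrow> ratfun" where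
  "branch_weight r 0 x = 1"
| "branch_weight r (Suc n) x
    = (1 + feedback E v r (parent x)) * branch_weight r n (parent x) / denom r (parent x) x"

definition tree_sol :: "'a \<Rightarrow> 'a \<Rightarrow> ratfun" where
  "tree_sol r x = branch_weight r (depth x) x"

lemma tree_sol_root: "r \<in> range v \<Longrightarrow> tree_sol r r = 1"
  using depth_eq_0_iff[of r] by (simp add: tree_sol_def)

lemma tree_sol_step:
  "x \<notin> range v \<Longrightarrow> tree_sol r x
    = (1 + feedback E v r (parent x)) * tree_sol r (parent x) / denom r (parent x) x"
  using depth_parent[of x] by (simp add: tree_sol_def)

text \<open>The form \<open>h = beta / (1 - beta)\<close> is the solution of
  \<open>(1 + h) * beta = h\<close>; it makes \<open>h\<close> the ratio of the sum over the
  children to the value at the vertex.\<close>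

lemma kids_sum_tree_sol:
  assumes "r \<in> range v" and "root u = r"
  shows "kids_sum (tree_sol r) u = feedback E v r u * tree_sol r u"
proof -
  have "tree_sol r s = (1 + feedback E v r u) * tree_sol r u * (1 / denom r u s)"
    if "s \<in> kids u" for s
    using that tree_sol_step[of s r] by (auto simp: kids_def)
  then have "kids_sum (tree_sol r) u = (1 + feedback E v r u) * tree_sol r u * beta r u"
    unfolding kids_sum_def beta_def by (simp add: sum_distrib_left)
  moreover have "1 - beta r u \<noteq> 0" using feedback_bounds[OF assms] by auto
  then have "(1 + feedback E v r u) * beta r u = feedback E v r u"
    by (simp add: feedback_eq[OF assms] field_simps)
  ultimately show ?thesis by (simp add: ac_simps)
qed

lemma tree_eq_tree_sol:
  assumes r: "r \<in> range v"
  shows "tree_eq ratfun_var r (tree_sol r)"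
  unfolding tree_eq_def
proof
  fix x assume x: "x \<in> twigs r"
  let ?u = "parent x" and ?Y = "tree_sol r" and ?h = "feedback E v r"
  have off: "x \<notin> range v" and rx: "root x = r" using x by (auto simp: twigs_def)
  then have ru: "root ?u = r" using root_parent by simp
  have kid: "x \<in> kids ?u" using off by (simp add: kids_def)
  have "ratfun_var \<le> denom r ?u x" using denom_ge[OF kid] feedback_bounds[OF r rx] by blast
  then have "denom r ?u x \<noteq> 0" using ratfun_var_infinite[of 0] by auto
  then have *: "?h ?u * ?Y ?u + ?Y ?u = denom r ?u x * ?Y x"
    using tree_sol_step[OF off, of r] by (simp add: field_simps)
  have du: "(of_nat (deg E ?u) :: ratfun) \<noteq> 0" and dx: "(of_nat (deg E x) :: ratfun) \<noteq> 0"
    using deg_parent_pos[OF off] deg_off_cycle_pos[OF off] by auto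
  \<comment> \<open>The denominator is built for this: \<open>(denom - 2) / deg\<close> at the
    parent equals \<open>ratfun_var + (1 - h) / deg\<close> with \<open>h\<close> and the last
    degree taken at \<open>x\<close>, and its second summand cancels the contribution of the end
    \<open>x\<close>.\<close>
  have "tree_op ?Y x = (?h x * ?Y x - ?Y x) / of_nat (deg E x)
      + (denom r ?u x * ?Y x - 2 * ?Y x) / of_nat (deg E ?u)"
    unfolding tree_op_def kids_sum_tree_sol[OF r rx] kids_sum_tree_sol[OF r ru] * ..
  also have "\<dots> = ratfun_var * ?Y x"
    using du dx unfolding denom_def by (simp add: field_simps)
  finally show "ratfun_var * ?Y x = tree_op ?Y x" ..
qed

text \<open>All divisions in \<open>tree_op\<close> are by positive degrees, so evaluation at
  \<open>l\<close> commutes with it. \<open>F\<close> is arbitrary because the lemma is applied to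
  the solution and also to its multiple with cleared poles.\<close>

lemma tree_eq_value:
  assumes r: "r \<in> range v" and eq: "tree_eq ratfun_var r F"
    and val: "\<And>x. x = r \<or> x \<in> twigs r \<Longrightarrow> has_value (F x) l (f x)"
  shows "tree_eq l r f"
  unfolding tree_eq_def
proof
  fix x assume x: "x \<in> twigs r"
  then have off: "x \<notin> range v" by (simp add: twigs_def)
  have ks: "has_value (kids_sum F u) l (kids_sum f u)" if "u = r \<or> u \<in> twigs r" for u
    unfolding kids_sum_def using val kids_in_tree[OF r that] by (intro has_value_sum) auto
  have two: "has_value 2 l 2" using has_value_of_nat[of 2 l] by simp
  have "has_value (tree_op F x) l (tree_op f x)"
    unfolding tree_op_def using x parent_in_tree[OF x] deg_parent_pos[OF off] deg_off_cycle_pos[OF off]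
    by (intro has_value_add has_value_diff has_value_divide_of_nat has_value_mult two ks val) auto
  moreover have "has_value (ratfun_var * F x) l (l * f x)"
    using x by (intro has_value_mult has_value_var val) auto
  ultimately show "l * f x = tree_op f x"
    using eq x has_value_unique by (auto simp: tree_eq_def)
qed

text \<open>
  If a coordinate of the solution had a pole at \<open>l\<close>, clearing the poles would leave at \<open>l\<close> a
  nonzero solution of the homogeneous equation, that is an eigenvector of the tree block.
\<close>

lemma tree_sol_regular:
  assumes r: "r \<in> range v" and l: "l \<notin> spectrum_on (ricci E) (tree_edges E v r)"
    and x: "x \<in> twigs r"
  shows "ratfun_regular (tree_sol r x) l"
proof (rule ccontr)
  assume "\<not> ratfun_regular (tree_sol r x) l"
  then obtain m y where m: "has_value m l 0"
    and y: "\<And>x. x \<in> twigs r \<Longrightarrow> has_value (m * tree_sol r x) l (y x)" and nz: "\<exists>x\<in>twigs r. y x \<noteq> 0"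
    using ratfun_scale_to_regular[of "twigs r" x "tree_sol r" l] x by (metis finite)
  \<comment> \<open>The solution is 1 at the root, so its multiple by \<open>m\<close> has there the
    value of \<open>m\<close> at \<open>l\<close>, which is 0.\<close>
  define f where "f u = (if u = r then 0 else y u)" for u
  have r': "r \<notin> twigs r" using r by (simp add: twigs_def)
  have "has_value (m * tree_sol r u) l (f u)" if "u = r \<or> u \<in> twigs r" for u
    using that y m tree_sol_root[OF r] by (auto simp: f_def)
  then have "tree_eq l r f"
    using tree_eq_value[OF r tree_eq_scale[OF tree_eq_tree_sol[OF r], of m]] by blast
  then have "f u = 0" if "u \<in> twigs r" for u
    using tree_eq_unique[OF r l _ _ that, of f] by (simp add: f_def)
  then show False using nz r' unfolding f_def by metis
qed

definition tree_val :: "real \<Rightarrow> 'a \<Rightarrow> 'a \<Rightarrow> real" where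
  "tree_val l r x = ratfun_eval (tree_sol r x) l"

text \<open>Since the solution is 1 at the root, \<open>Psi\<close> is its sum over the children of
  the root and inherits regularity from these summands.\<close>

lemma
  assumes r: "r \<in> range v" and l: "l \<notin> spectrum_on (ricci E) (tree_edges E v r)"
  shows tree_val_root: "tree_val l r r = 1"
    and tree_val_eq: "tree_eq l r (tree_val l r)"
    and Psi_regular: "ratfun_regular (Psi E v r) l"
    and Psi_eval: "ratfun_eval (Psi E v r) l = kids_sum (tree_val l r) r"
proof -
  have one: "has_value (tree_sol r r) l 1"
    using has_value_of_nat[of 1 l] by (simp add: tree_sol_root[OF r])
  then show "tree_val l r r = 1" by (simp add: tree_val_def ratfun_eval_eqI)
  have val: "has_value (tree_sol r x) l (tree_val l r x)" if "x = r \<or> x \<in> twigs r" for x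
    using that one tree_sol_regular[OF r l] ratfun_eval_eqI
    unfolding tree_val_def ratfun_regular_iff by metis
  then show "tree_eq l r (tree_val l r)" using tree_eq_value[OF r tree_eq_tree_sol[OF r]] by blast
  have "Psi E v r = kids_sum (tree_sol r) r"
    using kids_sum_tree_sol[OF r root_cycle[OF r]] by (simp add: Psi_def tree_sol_root[OF r])
  moreover have "has_value (kids_sum (tree_sol r) r) l (kids_sum (tree_val l r) r)"
    unfolding kids_sum_def using val kids_in_tree[OF r, of r] by (intro has_value_sum) auto
  ultimately show "ratfun_regular (Psi E v r) l"
    and "ratfun_eval (Psi E v r) l = kids_sum (tree_val l r) r"
    by (auto simp: ratfun_regular_iff ratfun_eval_eqI)
qed

section \<open>Elimination of a pendant tree\<close>

text \<open>Subtracting \<open>y r\<close> times the normalised solution leaves a solution with root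
  value 0.\<close>

lemma tree_eq_solution:
  assumes r: "r \<in> range v" and l: "l \<notin> spectrum_on (ricci E) (tree_edges E v r)"
    and eq: "tree_eq l r y" and x: "x \<in> twigs r"
  shows "y x = y r * tree_val l r x"
proof -
  have "tree_eq l r (\<lambda>x. y x - y r * tree_val l r x)"
    using eq tree_eq_scale[OF tree_val_eq[OF r l]] by (rule tree_eq_diff)
  then show ?thesis using tree_eq_unique[OF r l _ _ x] tree_val_root[OF r l] by fastforce
qed

lemma sum_pendant_root:
  assumes l: "l \<notin> spectrum_on (ricci E) (tree_edges E v (v j))"
    and eq: "\<forall>e\<in>tree_edges E v (v j). mat_vec (ricci E) E z e = l * z e"
  shows "(\<Sum>e | e \<in> pendant \<and> v j \<in> e. z e)
    = ratfun_eval (Psi E v (v j)) l * (z (cyc j) + z (cyc (j + 1)))"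
proof -
  let ?a = "z (cyc j) + z (cyc (j + 1))"
  have r: "v j \<in> range v" by simp
  have "tree_eq l (v j) (vertex_fun ?a z)" using eq tree_equations_iff by blast
  then have "vertex_fun ?a z x = ?a * tree_val l (v j) x" if "x \<in> twigs (v j)" for x
    using tree_eq_solution[OF r l _ that] by (fastforce simp: vertex_fun_def)
  then have "kids_sum (vertex_fun ?a z) (v j) = ?a * kids_sum (tree_val l (v j)) (v j)"
    unfolding kids_sum_def sum_distrib_left using kids_in_tree[OF r, of "v j"]
    by (intro sum.cong) auto
  then show ?thesis
    by (simp add: sum_pendant_at Psi_eval[OF r l] kids_sum_vertex_fun vertex_fun_def mult.commute)
qed

text \<open>A tree meets the cycle only in its root.\<close>

lemma ricci_tree_cycle:
  assumes "e \<in> tree_edges E v (v j)" and "c \<in> cycle_edges v"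
  shows "ricci E e c = (if v j \<in> c \<and> v j \<in> e then 1 / real (deg E (v j)) else 0)"
    and "ricci E c e = (if v j \<in> c \<and> v j \<in> e then 1 / real (deg E (v j)) else 0)"
proof -
  have "e \<noteq> c" using assms tree_edges_subset edges_split(2) by blast
  moreover have "e \<inter> c \<subseteq> {v j}"
  proof
    fix x assume x: "x \<in> e \<inter> c"
    then have "x \<in> range v" using assms(2) cycle_edge_subset by blast
    moreover have "root x = v j" using x assms(1) by (auto simp: tree_edges_def tree_verts_eq)
    ultimately show "x \<in> {v j}" using root_cycle by simp
  qed
  then have "e \<inter> c = (if v j \<in> c \<and> v j \<in> e then {v j} else {})" by auto
  ultimately show "ricci E e c = (if v j \<in> c \<and> v j \<in> e then 1 / real (deg E (v j)) else 0)"
    "ricci E c e = (if v j \<in> c \<and> v j \<in> e then 1 / real (deg E (v j)) else 0)"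
    by (auto simp: ricci_def Int_commute[of c e])
qed

text \<open>Replacing the root value 1 by 0 changes the equation only on the edges at the root, by
  \<open>1 / deg E r\<close>. The normalised solution thus solves the resolvent equation whose
  right-hand side is the coupling to a cycle edge at \<open>r\<close>.\<close>

lemma tree_val_column:
  assumes r: "r \<in> range v" and l: "l \<notin> spectrum_on (ricci E) (tree_edges E v r)"
    and e: "e \<in> tree_edges E v r"
  shows "l * edge_fun (tree_val l r) e - mat_vec (ricci E) (tree_edges E v r) (edge_fun (tree_val l r)) e
    = (if r \<in> e then 1 / real (deg E r) else 0)"
proof -
  let ?y = "tree_val l r"
  obtain x where x: "x \<in> twigs r" "e = parent_edge x" using e by (auto simp: tree_edges_eq[OF r])
  then have off: "x \<notin> range v" by (simp add: twigs_def)
  have y: "vertex_fun 0 (edge_fun ?y) u = (if u = r then 0 else ?y u)" if "u = r \<or> u \<in> twigs r" for u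
    using that r by (auto simp: vertex_fun_def twigs_def)
  have "tree_op ?y x = tree_op (vertex_fun 0 (edge_fun ?y)) x
      + (if parent x = r then 1 / real (deg E r) else 0)"
    using x(1) off r parent_in_tree[OF x(1)] tree_val_root[OF r l]
    by (auto simp: tree_op_def kids_sum_edge_fun y add_divide_distrib diff_divide_distrib)
  moreover have "l * ?y x = tree_op ?y x" using tree_val_eq[OF r l] x(1) by (simp add: tree_eq_def)
  moreover have "r \<in> e \<longleftrightarrow> parent x = r" using x off r by auto
  ultimately show ?thesis using x off mat_vec_tree[OF r x(1)] by simp
qed

text \<open>Both cycle edges at \<open>v j\<close> couple to the tree through the same vector
  \<open>b\<close>, so every nonzero entry is the one number \<open>b N b\<close>. Here
  \<open>N b\<close> is the normalised solution, and pairing it with \<open>b\<close> sums it over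
  the root edges and divides by the degree.\<close>

lemma schur_complement:
  assumes l: "l \<notin> spectrum_on (ricci E) (tree_edges E v (v j))"
  shows "\<exists>N. inverse_on (\<lambda>e f. (if e = f then l else 0) - ricci E e f) (tree_edges E v (v j)) N \<and>
    (\<forall>c\<in>cycle_edges v. \<forall>c'\<in>cycle_edges v.
      (\<Sum>e\<in>tree_edges E v (v j). \<Sum>f\<in>tree_edges E v (v j). ricci E c e * N e f * ricci E f c')
      = (if v j \<in> c \<inter> c' then ratfun_eval (Psi E v (v j)) l / real (deg E (v j)) else 0))"
proof -
  let ?T = "tree_edges E v (v j)" and ?d = "real (deg E (v j))"
  let ?A = "\<lambda>e f. (if e = f then l else 0) - ricci E e f"
  let ?y = "edge_fun (tree_val l (v j))"
  have r: "v j \<in> range v" by simp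
  have A: "mat_vec ?A ?T z e = l * z e - mat_vec (ricci E) ?T z e" if "e \<in> ?T" for z e
  proof -
    have "mat_vec ?A ?T z e = (\<Sum>f\<in>?T. (if e = f then l * z f else 0) - ricci E e f * z f)"
      unfolding mat_vec_def by (intro sum.cong) (auto simp: left_diff_distrib)
    then show ?thesis using that by (simp add: mat_vec_def sum_subtractf)
  qed
  have "\<exists>N. inverse_on ?A ?T N"
  proof (rule inverse_on_exists, rule ccontr)
    fix z e assume "\<And>e. e \<in> ?T \<Longrightarrow> mat_vec ?A ?T z e = 0" and "e \<in> ?T" "z e \<noteq> 0"
    then have "eigenvector_on (ricci E) ?T l z" using A by (fastforce simp: eigenvector_on_def)
    then show False using l by (auto simp: spectrum_on_def)
  qed
  then obtain N where N: "inverse_on ?A ?T N" by blast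
  define b where "b f = (if v j \<in> f then 1 / ?d else 0)" for f
  have Nb: "(\<Sum>f\<in>?T. N e f * b f) = ?y e" if e: "e \<in> ?T" for e
  proof -
    have "(\<Sum>f\<in>?T. N e f * b f) = (\<Sum>f\<in>?T. N e f * mat_vec ?A ?T ?y f)"
      using A tree_val_column[OF r l] by (intro sum.cong) (auto simp: b_def)
    also have "\<dots> = (\<Sum>h\<in>?T. (\<Sum>f\<in>?T. N e f * ?A f h) * ?y h)"
      unfolding mat_vec_def sum_distrib_left sum_distrib_right
      by (subst sum.swap) (simp add: mult.assoc)
    also have "\<dots> = (\<Sum>h\<in>?T. if e = h then ?y h else 0)"
      using N e unfolding inverse_on_def by (intro sum.cong) auto
    also have "\<dots> = ?y e" using e by simp
    finally show ?thesis .
  qed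
  have "(\<Sum>e\<in>?T. b e * ?y e) = (\<Sum>e | e \<in> ?T \<and> v j \<in> e. ?y e) / ?d"
    unfolding sum_divide_distrib by (rule sum.mono_neutral_cong_right) (auto simp: b_def)
  also have "(\<Sum>e | e \<in> ?T \<and> v j \<in> e. ?y e) = kids_sum (vertex_fun 0 ?y) (v j)"
    using sum_tree_at[OF r, of "v j" ?y] by (simp add: sum_pendant_at vertex_fun_def)
  also have "\<dots> = kids_sum (tree_val l (v j)) (v j)"
    by (rule kids_sum_edge_fun)
  finally have psi: "(\<Sum>e\<in>?T. b e * ?y e) = ratfun_eval (Psi E v (v j)) l / ?d"
    by (simp add: Psi_eval[OF r l])
  have "(\<Sum>e\<in>?T. \<Sum>f\<in>?T. ricci E c e * N e f * ricci E f c')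
      = (if v j \<in> c \<inter> c' then ratfun_eval (Psi E v (v j)) l / ?d else 0)"
    if c: "c \<in> cycle_edges v" "c' \<in> cycle_edges v" for c c'
  proof -
    have "(\<Sum>e\<in>?T. \<Sum>f\<in>?T. ricci E c e * N e f * ricci E f c')
        = (\<Sum>e\<in>?T. \<Sum>f\<in>?T. (if v j \<in> c \<inter> c' then 1 else 0) * (b e * (N e f * b f)))"
      using c by (intro sum.cong) (auto simp: ricci_tree_cycle b_def)
    also have "\<dots> = (if v j \<in> c \<inter> c' then 1 else 0) * (\<Sum>e\<in>?T. b e * (\<Sum>f\<in>?T. N e f * b f))"
      by (simp only: sum_distrib_left)
    also have "(\<Sum>e\<in>?T. b e * (\<Sum>f\<in>?T. N e f * b f)) = (\<Sum>e\<in>?T. b e * ?y e)"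
      using Nb by (intro sum.cong) auto
    finally show ?thesis by (simp add: psi)
  qed
  then show ?thesis using N by blast
qed

section \<open>The periodic problem along the cycle\<close>

text \<open>Only the pendant equations are assumed, so the equivalence serves to pass from
  eigenvectors to the recurrence and back.\<close>

lemma cycle_equation_iff:
  assumes l: "l \<notin> (\<Union>j. spectrum_on (ricci E) (tree_edges E v (v j)))"
    and eq: "\<forall>e\<in>pendant. mat_vec (ricci E) E z e = l * z e"
  shows "mat_vec (ricci E) E z (cyc j) = l * z (cyc j) \<longleftrightarrow>
    coeff_P E v l j * z (cyc (j + 1)) = coeff_Q E v l j * z (cyc j) - coeff_P E v l (j - 1) * z (cyc (j - 1))"
proof -
  have s: "(\<Sum>f | f \<in> pendant \<and> v i \<in> f. z f)
      = ratfun_eval (Psi E v (v i)) l * (z (cyc i) + z (cyc (i + 1)))" for i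
    using l eq tree_edges_subset by (intro sum_pendant_root) blast+
  have "mat_vec (ricci E) E z (cyc j) - l * z (cyc j)
    = coeff_P E v l j * z (cyc (j + 1)) - (coeff_Q E v l j * z (cyc j) - coeff_P E v l (j - 1) * z (cyc (j - 1)))"
    unfolding mat_vec_cycle s coeff_P_def coeff_Q_def
    by (simp add: algebra_simps add_divide_distrib diff_divide_distrib)
  then show ?thesis by auto
qed

section \<open>Transfer matrices and periodic solutions of the recurrence\<close>

definition partial_monodromy :: "real \<Rightarrow> nat \<Rightarrow> real^2^2" where
  "partial_monodromy l n = monodromy E n v l"

lemma partial_monodromy_0: "partial_monodromy l 0 = mat 1"
  by (simp add: partial_monodromy_def monodromy_def)

lemma partial_monodromy_Suc:
  "partial_monodromy l (Suc n) = transfer_mat E v l (int (Suc n)) ** partial_monodromy l n"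
proof -
  have "[1..int (Suc n)] = [1..int n] @ [int (Suc n)]"
    using upto_rec2[of 1 "int (Suc n)"] by simp
  then show ?thesis by (simp add: partial_monodromy_def monodromy_def)
qed

lemma transfer_mat_mult:
  "(transfer_mat E v l j *v x) $ 1
    = coeff_Q E v l j / coeff_P E v l j * x $ 1 - coeff_P E v l (j - 1) / coeff_P E v l j * x $ 2"
  "(transfer_mat E v l j *v x) $ 2 = x $ 1"
  by (simp_all add: transfer_mat_def matrix_vector_mult_def sum_2)

text \<open>The determinant of one transfer matrix is \<open>P\<close> at \<open>j - 1\<close> over
  \<open>P\<close> at \<open>j\<close>, so the product telescopes; over a full period it is
  1.\<close>

lemma det_partial_monodromy:
  assumes "\<And>j. coeff_P E v l j \<noteq> 0"
  shows "det (partial_monodromy l n) = coeff_P E v l 0 / coeff_P E v l (int n)"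
proof (induction n)
  case (Suc n)
  have "det (transfer_mat E v l (int (Suc n))) = coeff_P E v l (int n) / coeff_P E v l (int (Suc n))"
    by (simp add: transfer_mat_def det_2)
  then show ?case using Suc assms by (simp add: partial_monodromy_Suc det_mul)
qed (use assms in \<open>simp add: partial_monodromy_0\<close>)

lemma coeff_P_periodic: "coeff_P E v l (j + int g) = coeff_P E v l j"
  by (simp add: coeff_P_def v_periodic)

lemma cycle_edge_periodic: "cyc (j + int g) = cyc j"
  by (simp add: cycle_edge_eq_iff)

definition cycle_recurrence :: "real \<Rightarrow> (int \<Rightarrow> real) \<Rightarrow> int \<Rightarrow> bool" where
  "cycle_recurrence l w j \<longleftrightarrow>
    coeff_P E v l j * w (j + 1) = coeff_Q E v l j * w j - coeff_P E v l (j - 1) * w (j - 1)"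

lemma partial_monodromy_recurrence:
  assumes P: "\<And>j. coeff_P E v l j \<noteq> 0"
    and rec: "\<And>j. 1 \<le> j \<Longrightarrow> j \<le> int n \<Longrightarrow> cycle_recurrence l w j"
  shows "partial_monodromy l n *v vector [w 1, w 0] = vector [w (int n + 1), w (int n)]"
  using rec
proof (induction n)
  case (Suc n)
  have "cycle_recurrence l w (int n + 1)" using Suc.prems by simp
  then have "w (int n + 2) = coeff_Q E v l (int n + 1) / coeff_P E v l (int n + 1) * w (int n + 1)
      - coeff_P E v l (int n) / coeff_P E v l (int n + 1) * w (int n)"
    using P[of "int n + 1"] by (simp add: cycle_recurrence_def field_simps)
  moreover have "partial_monodromy l n *v vector [w 1, w 0] = vector [w (int n + 1), w (int n)]"
    using Suc by simp
  moreover have "int (Suc n) = int n + 1" by simp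
  ultimately show ?case
    unfolding partial_monodromy_Suc matrix_vector_mul_assoc[symmetric]
    by (simp only:) (simp add: vec_eq_iff forall_2 transfer_mat_mult add.commute)
qed (simp add: partial_monodromy_0)

text \<open>Fixed vectors of the monodromy are the initial data \<open>(w 1, w 0)\<close> of
  periodic solutions.\<close>

lemma periodic_solution_iff:
  assumes P: "\<And>j. coeff_P E v l j \<noteq> 0"
  shows "trace (monodromy E g v l) = 2 \<longleftrightarrow>
    (\<exists>w. (\<forall>j. w (j + int g) = w j) \<and> (\<forall>j. cycle_recurrence l w j) \<and> (\<exists>j. w j \<noteq> 0))"
    (is "_ \<longleftrightarrow> (\<exists>w. ?sol w)")
proof -
  let ?M = "partial_monodromy l g"
  have "det ?M = 1" using det_partial_monodromy[OF P] coeff_P_periodic[of l 0] P by simp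
  then have *: "trace (monodromy E g v l) = 2 \<longleftrightarrow> (\<exists>x. x \<noteq> 0 \<and> ?M *v x = x)"
    using trace_2_iff_fixed_vector by (simp add: partial_monodromy_def)
  show ?thesis unfolding *
  proof
    assume "\<exists>w. ?sol w"
    then obtain w k where per: "\<And>j. w (j + int g) = w j" and rec: "\<And>j. cycle_recurrence l w j"
      and nz: "w k \<noteq> 0" by blast
    define x :: "real^2" where "x = vector [w 1, w 0]"
    have "?M *v x = vector [w (int g + 1), w (int g)]"
      unfolding x_def using partial_monodromy_recurrence[OF P] rec by blast
    then have fixed: "?M *v x = x" using per[of 1] per[of 0] by (simp add: x_def add.commute)
    have "x \<noteq> 0"
    proof
      assume 0: "x = 0"
      have "w (int n) = 0" for n
      proof -
        have "partial_monodromy l n *v x = vector [w (int n + 1), w (int n)]"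
          unfolding x_def using partial_monodromy_recurrence[OF P] rec by blast
        then show ?thesis using 0 by (simp add: vec_eq_iff forall_2)
      qed
      moreover have "w (k + int g * int n) = w k" for n
        by (rule periodic_cong[of w, OF per]) simp
      \<comment> \<open>The iteration reaches only nonnegative indices; shifting \<open>k\<close> by
        \<open>g * \<bar>k\<bar>\<close> gets there without changing \<open>w\<close>.\<close>
      moreover have "k + int g * int (nat \<bar>k\<bar>) = int (nat (k + int g * \<bar>k\<bar>))"
      proof -
        have "\<bar>k\<bar> \<le> int g * \<bar>k\<bar>" using g_ge_3 by (simp add: mult_le_cancel_right1)
        then show ?thesis by simp
      qed
      ultimately show False using nz by metis
    qed
    then show "\<exists>x. x \<noteq> 0 \<and> ?M *v x = x" using fixed by blast
  next
    assume "\<exists>x. x \<noteq> 0 \<and> ?M *v x = x"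
    then obtain x where x: "x \<noteq> 0" and fixed: "?M *v x = x" by blast
    define u where "u n = (partial_monodromy l n *v x) $ 2" for n
    have u1: "(partial_monodromy l n *v x) $ 1 = u (Suc n)" for n
      by (simp add: u_def partial_monodromy_Suc transfer_mat_mult flip: matrix_vector_mul_assoc)
    have rec: "coeff_P E v l (int n + 1) * u (Suc (Suc n))
        = coeff_Q E v l (int n + 1) * u (Suc n) - coeff_P E v l (int n) * u n" for n
    proof -
      have "u (Suc (Suc n)) = (partial_monodromy l (Suc n) *v x) $ 1" by (simp add: u1)
      also have "\<dots> = coeff_Q E v l (int n + 1) / coeff_P E v l (int n + 1) * u (Suc n)
          - coeff_P E v l (int n) / coeff_P E v l (int n + 1) * u n"
        unfolding partial_monodromy_Suc matrix_vector_mul_assoc[symmetric] transfer_mat_mult u1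
        by (simp add: u_def add.commute)
      finally show ?thesis using P[of "int n + 1"] by (simp add: field_simps)
    qed
    have ug: "u g = u 0" "u (Suc g) = u 1"
      using u1[of g] u1[of 0] by (simp_all add: fixed partial_monodromy_0) (simp add: u_def fixed partial_monodromy_0)
    \<comment> \<open>The fixed vector gives agreement of \<open>w\<close> with \<open>u\<close> up
      to index \<open>Suc g\<close>, and that suffices: the recurrence over one period reads
      \<open>u\<close> at most at \<open>Suc (Suc n)\<close> with \<open>n < g\<close>.\<close>
    define w where "w j = u (nat (j mod int g))" for j
    have per: "w (j + int g) = w j" for j by (simp add: w_def)
    have wn: "w (int n) = u n" if "n \<le> Suc g" for n
    proof -
      have "n < g \<or> n = g \<or> n = Suc g" using that by auto
      moreover have "int (Suc g) mod int g = 1" using g_ge_3 by (simp flip: zmod_int)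
      ultimately show ?thesis using ug by (auto simp: w_def)
    qed
    have "cycle_recurrence l w j" for j
    proof -
      define n where "n = nat ((j - 1) mod int g)"
      have n: "int n = (j - 1) mod int g" and "n < g"
        using g_ge_3 by (simp_all add: n_def nat_less_iff)
      have "int g dvd (j - 1) - int n" unfolding n by (simp add: minus_mod_eq_mult_div)
      then have dvd: "int g dvd (j + k) - (int n + 1 + k)" for k by (simp add: algebra_simps)
      have w: "w (j + k) = w (int n + 1 + k)" for k
        unfolding w_def using dvd[of k] by (metis mod_eq_dvd_iff)
      have v: "v (j + k) = v (int n + 1 + k)" for k using dvd[of k] by (simp add: v_eq_iff)
      have "coeff_P E v l j = coeff_P E v l (int n + 1)" "coeff_P E v l (j - 1) = coeff_P E v l (int n)"
        "coeff_Q E v l j = coeff_Q E v l (int n + 1)"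
        using v[of 0] v[of "- 1"] by (simp_all add: coeff_P_def coeff_Q_def)
      moreover have "w (j + 1) = u (Suc (Suc n))" "w j = u (Suc n)" "w (j - 1) = u n"
        using w[of 1] w[of 0] w[of "- 1"] wn[of n] wn[of "Suc n"] wn[of "Suc (Suc n)"] \<open>n < g\<close>
        by (simp_all add: algebra_simps)
      ultimately show ?thesis using rec[of n] by (simp add: cycle_recurrence_def)
    qed
    moreover have "w 0 \<noteq> 0 \<or> w 1 \<noteq> 0"
    proof -
      have "x $ 2 = w 0" "x $ 1 = w 1"
        using wn[of 0] wn[of 1] u1[of 0] by (simp_all add: u_def partial_monodromy_0)
      then show ?thesis using x by (auto simp: vec_eq_iff forall_2)
    qed
    ultimately have "?sol w" using per by blast
    then show "\<exists>w. ?sol w" by blast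
  qed
qed

text \<open>On each tree the normalised solution is scaled by the sum of the two prescribed cycle
  values at its root.\<close>

lemma extend_to_pendant:
  assumes l: "l \<notin> (\<Union>j. spectrum_on (ricci E) (tree_edges E v (v j)))"
    and per: "\<And>j. w (j + int g) = w j"
  obtains z where "\<And>j. z (cyc j) = w j" and "\<forall>e\<in>pendant. mat_vec (ricci E) E z e = l * z e"
proof -
  \<comment> \<open>The index is determined only up to multiples of \<open>g\<close>, which the
    periodicity of \<open>w\<close> absorbs.\<close>
  define idx where "idx x = (SOME j. root x = v j)" for x
  define y where "y x = (w (idx x) + w (idx x + 1)) * tree_val l (root x) x" for x
  define z where "z e = (if e \<in> cycle_edges v then w (SOME j. e = cyc j) else edge_fun y e)" for e
  have zc: "z (cyc j) = w j" for j
  proof -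
    have "cyc j = cyc (SOME i. cyc j = cyc i)" by (rule someI) simp
    then have "w j = w (SOME i. cyc j = cyc i)"
      by (intro periodic_cong[of w, OF per]) (simp add: cycle_edge_eq_iff)
    then show ?thesis by (simp add: z_def)
  qed
  have "mat_vec (ricci E) E z e = l * z e" if e: "e \<in> pendant" for e
  proof -
    obtain x where x: "x \<notin> range v" "e = parent_edge x" using e by (auto simp: pendant_eq)
    obtain j where j: "root x = v j" using root_mem[of x] by auto
    have r: "v j \<in> range v" by simp
    have lj: "l \<notin> spectrum_on (ricci E) (tree_edges E v (v j))" using l by blast
    let ?a = "z (cyc j) + z (cyc (j + 1))"
    have "vertex_fun ?a z u = ?a * tree_val l (v j) u" if u: "u = v j \<or> u \<in> twigs (v j)" for u
    proof (cases "u = v j")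
      case True
      then show ?thesis by (simp add: vertex_fun_def tree_val_root[OF r lj])
    next
      case False
      then have off: "u \<notin> range v" and ru: "root u = v j" using u by (auto simp: twigs_def)
      have "v j = v (idx u)" unfolding idx_def ru by (rule someI[of _ j]) simp
      then have dvd: "int g dvd j - idx u" by (simp add: v_eq_iff)
      have w: "w (idx u) = w j" "w (idx u + 1) = w (j + 1)"
        using periodic_cong[of w, OF per dvd] periodic_cong[of w g "j + 1" "idx u + 1", OF per] dvd
        by simp_all
      have "parent_edge u \<notin> cycle_edges v" using off cycle_edge_subset by blast
      then have "z (parent_edge u) = y u" using off by (simp add: z_def)
      then show ?thesis using off w ru by (simp add: vertex_fun_def y_def zc)
    qed
    then have "tree_eq l (v j) (vertex_fun ?a z) \<longleftrightarrow> tree_eq l (v j) (\<lambda>u. ?a * tree_val l (v j) u)"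
      by (rule tree_eq_cong[OF r])
    then have "tree_eq l (v j) (vertex_fun ?a z)"
      using tree_eq_scale[OF tree_val_eq[OF r lj]] by simp
    then have "\<forall>e\<in>tree_edges E v (v j). mat_vec (ricci E) E z e = l * z e"
      using tree_equations_iff by blast
    moreover have "e \<in> tree_edges E v (v j)" using x j by (simp add: tree_edges_eq twigs_def)
    ultimately show ?thesis by blast
  qed
  then show thesis using that zc by blast
qed

text \<open>Restriction to the cycle edges turns an eigenvector into a periodic solution, and
  \<open>extend_to_pendant\<close> goes back. A nonzero cycle coordinate corresponds to a solution
  that is not identically zero.\<close>

lemma eigenvector_iff_trace:
  assumes l: "l \<notin> (\<Union>j. spectrum_on (ricci E) (tree_edges E v (v j)))"
    and P: "\<And>j. coeff_P E v l j \<noteq> 0"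
  shows "(\<exists>z. eigenvector_on (ricci E) E l z \<and> (\<exists>c\<in>cycle_edges v. z c \<noteq> 0))
    \<longleftrightarrow> trace (monodromy E g v l) = 2"
  unfolding periodic_solution_iff[OF P]
proof
  assume "\<exists>z. eigenvector_on (ricci E) E l z \<and> (\<exists>c\<in>cycle_edges v. z c \<noteq> 0)"
  then obtain z j where eig: "\<forall>e\<in>E. mat_vec (ricci E) E z e = l * z e" and nz: "z (cyc j) \<noteq> 0"
    by (auto simp: eigenvector_on_def)
  have pend: "\<forall>e\<in>pendant. mat_vec (ricci E) E z e = l * z e" using eig pendant_subset by blast
  have "cycle_recurrence l (\<lambda>j. z (cyc j)) i" for i
    unfolding cycle_recurrence_def using cycle_equation_iff[OF l pend, of i] eig cycle_edge_mem[of i]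
    by blast
  moreover have "z (cyc (i + int g)) = z (cyc i)" for i by (simp add: cycle_edge_periodic)
  ultimately show "\<exists>w. (\<forall>j. w (j + int g) = w j) \<and> (\<forall>j. cycle_recurrence l w j) \<and> (\<exists>j. w j \<noteq> 0)"
    using nz by (intro exI[of _ "\<lambda>j. z (cyc j)"]) blast
next
  assume "\<exists>w. (\<forall>j. w (j + int g) = w j) \<and> (\<forall>j. cycle_recurrence l w j) \<and> (\<exists>j. w j \<noteq> 0)"
  then obtain w k where per: "\<And>j. w (j + int g) = w j" and rec: "\<And>j. cycle_recurrence l w j"
    and nz: "w k \<noteq> 0" by blast
  obtain z where z: "\<And>j. z (cyc j) = w j" and pend: "\<forall>e\<in>pendant. mat_vec (ricci E) E z e = l * z e"
    using extend_to_pendant[OF l, of w] per by blast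
  have "mat_vec (ricci E) E z (cyc j) = l * z (cyc j)" for j
    using cycle_equation_iff[OF l pend, of j] rec[of j] by (simp add: z cycle_recurrence_def)
  then have "\<forall>e\<in>E. mat_vec (ricci E) E z e = l * z e" using pend edges_split(1) by blast
  moreover have "z (cyc k) \<noteq> 0" using nz z by simp
  ultimately show "\<exists>z. eigenvector_on (ricci E) E l z \<and> (\<exists>c\<in>cycle_edges v. z c \<noteq> 0)"
    unfolding eigenvector_on_def using cycle_edge_mem[of k] by blast
qed

end

theorem theoremB:
  fixes E :: "'a::finite set set" and g :: nat and v :: "int \<Rightarrow> 'a"
  assumes "unicyclic E" and "is_cycle E g v" and "balanced E g v"
  shows
    "(\<forall>(j::int) (l::real). l \<notin> spectrum_on (ricci E) (tree_edges E v (v j)) \<longrightarrow>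
        ratfun_regular (Psi E v (v j)) l \<and>
        (\<exists>N. inverse_on (\<lambda>e f. (if e = f then l else 0) - ricci E e f) (tree_edges E v (v j)) N \<and>
             (\<forall>c\<in>cycle_edges v. \<forall>c'\<in>cycle_edges v.
                (\<Sum>e\<in>tree_edges E v (v j). \<Sum>f\<in>tree_edges E v (v j).
                    ricci E c e * N e f * ricci E f c')
                = (if v j \<in> c \<inter> c' then ratfun_eval (Psi E v (v j)) l / real (deg E (v j)) else 0))) \<and>
        (\<forall>z. (\<forall>e\<in>tree_edges E v (v j). mat_vec (ricci E) E z e = l * z e) \<longrightarrow>
             (\<Sum>e | e \<in> pendant_edges E v \<and> v j \<in> e. z e)
             = ratfun_eval (Psi E v (v j)) l * (z (cycle_edge v j) + z (cycle_edge v (j + 1)))))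
   \<and> (\<forall>l::real. l \<notin> (\<Union>j. spectrum_on (ricci E) (tree_edges E v (v j))) \<longrightarrow>
        (\<forall>z. (\<forall>e\<in>pendant_edges E v. mat_vec (ricci E) E z e = l * z e) \<longrightarrow>
           (\<forall>j. mat_vec (ricci E) E z (cycle_edge v j) = l * z (cycle_edge v j) \<longleftrightarrow>
              coeff_P E v l j * z (cycle_edge v (j + 1))
              = coeff_Q E v l j * z (cycle_edge v j)
                - coeff_P E v l (j - 1) * z (cycle_edge v (j - 1)))))
   \<and> (\<forall>l::real. l \<notin> (\<Union>j. spectrum_on (ricci E) (tree_edges E v (v j))) \<longrightarrow>
        (\<forall>j. coeff_P E v l j \<noteq> 0) \<longrightarrow>
        ((\<exists>z. eigenvector_on (ricci E) E l z \<and> (\<exists>c\<in>cycle_edges v. z c \<noteq> 0))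
         \<longleftrightarrow> trace (monodromy E g v l) = 2))"
proof -
  interpret unicyclic_cycle E g v using assms(1,2) by (rule unicyclic_cycle.intro)
  show ?thesis (is "(\<forall>j l. _ \<longrightarrow> ?tree j l) \<and> (\<forall>l. _ \<longrightarrow> (\<forall>z. _ \<longrightarrow> (\<forall>j. ?cycle l z j))) \<and> (\<forall>l. _ \<longrightarrow> _ \<longrightarrow> ?trace l)")
  proof (rule conjI[OF _ conjI]; intro allI impI)
    fix j l assume l: "l \<notin> spectrum_on (ricci E) (tree_edges E v (v j))"
    show "?tree j l"
      using Psi_regular[OF rangeI l] schur_complement[OF l] sum_pendant_root[OF l] by blast
  next
    fix l z j assume "l \<notin> (\<Union>j. spectrum_on (ricci E) (tree_edges E v (v j)))"
      and "\<forall>e\<in>pendant. mat_vec (ricci E) E z e = l * z e"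
    then show "?cycle l z j" by (rule cycle_equation_iff)
  next
    fix l assume "l \<notin> (\<Union>j. spectrum_on (ricci E) (tree_edges E v (v j)))"
      and "\<forall>j. coeff_P E v l j \<noteq> 0"
    then show "?trace l" using eigenvector_iff_trace by blast
  qed
qed

end
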